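(* Let $p\ge 2$ and let $(Y,d_Y)$ be a complete geodesic metric space which is $p$-uniformly convex and admits a sequence of high girth $p$-expanders $\{G_n=(V_n,E_n)\}_{n=1}^\infty$. Then for all integers $d\ge 2$ and $j\ge 1$, with probability tending to $1$ as $n\to\infty$, every isometric action of the random group $\Gamma(G_n,d,j)$ on $Y$ has a common fixed point.
   Context: A geodesic metric space $(Y,d_Y)$ is $p$-uniformly convex if there is $c>0$ such that for all $x,y,z\in Y$, every geodesic segment $\gamma:[0,1]\to Y$ (parametrized proportionally to arc length) with $\gamma(0)=y$, $\gamma(1)=z$, and every $t\in[0,1]$: $d_Y(x,\gamma(t))^p\le (1-t)d_Y(x,y)^p+t\,d_Y(x,z)^p-c\,t(1-t)d_Y(y,z)^p$. $(Y,d_Y)$ admits a sequence of high girth $p$-expanders if there exist $k\in\mathbb N$, $\gamma,\eta>0$ and a sequence of finite $k$-regular graphs $G_n=(V_n,E_n)$ with $|V_n|\to\infty$, such that the girth (length of the shortest cycle) of $G_n$ is at least $\eta\log|V_n|$, and for every $n$ and every $f:V_n\to Y$: $\frac{1}{|V_n|^2}\sum_{u,v\in V_n}d_Y(f(u),f(v))^p\le \frac{\gamma}{|E_n|}\sum_{uv\in E_n}d_Y(f(u),f(v))^p$. Random group $\Gamma(G,d,j)$ for a graph $G=(V,E)$ and integers $d,j$: orient the edges of $G$ arbitrarily; independently for each edge $e$ choose a word $w_e$ of length $j$ in the letters $s_1,\dots,s_d,s_1^{-1},\dots,s_d^{-1}$, uniformly among all $(2d)^j$ such words. Each cycle of $G$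 yields a relator obtained by traversing the cycle and multiplying, for each traversed edge $e$, by $w_e$ or $w_e^{-1}$ according to whether $e$ is traversed along or against its orientation. $\Gamma(G,d,j)$ is the group generated by $s_1,\dots,s_d$ subject to all these relators. *)

theory Defs
  imports "HOL-Analysis.Analysis" "HOL-Algebra.Algebra"
begin

definition geodesic_segment :: "(real \<Rightarrow> 'a::metric_space) \<Rightarrow> 'a \<Rightarrow> 'a \<Rightarrow> bool" where
  "geodesic_segment g y z \<longleftrightarrow> g 0 = y \<and> g 1 = z \<and>
     (\<forall>s\<in>{0..1}. \<forall>t\<in>{0..1}. dist (g s) (g t) = \<bar>s - t\<bar> * dist y z)"

definition geodesic_space :: "'a::metric_space itself \<Rightarrow> bool" where
  "geodesic_space _ \<longleftrightarrow> (\<forall>y z::'a. \<exists>g. geodesic_segment g y z)"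

definition p_uniformly_convex :: "real \<Rightarrow> 'a::metric_space itself \<Rightarrow> bool" where
  "p_uniformly_convex p _ \<longleftrightarrow> (\<exists>c>0. \<forall>x y z::'a. \<forall>g. geodesic_segment g y z \<longrightarrow>
     (\<forall>t\<in>{0..1}. dist x (g t) powr p \<le>
        (1 - t) * dist x y powr p + t * dist x z powr p - c * t * (1 - t) * dist y z powr p))"

text \<open>A finite simple graph on vertices of type nat is given by a vertex set V and a set E
  of edges (u,v) with u < v; the edge {u,v} is oriented from u to v.\<close>

definition simple_graph :: "nat set \<Rightarrow> (nat \<times> nat) set \<Rightarrow> bool" where
  "simple_graph V E \<longleftrightarrow> finite V \<and> E \<subseteq> V \<times> V \<and> (\<forall>(u,v)\<in>E. u < v)"

definition adj :: "(nat \<times> nat) set \<Rightarrow> nat \<Rightarrow> nat \<Rightarrow> bool" where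
  "adj E u v \<longleftrightarrow> (u,v) \<in> E \<or> (v,u) \<in> E"

definition regular_graph :: "nat \<Rightarrow> nat set \<Rightarrow> (nat \<times> nat) set \<Rightarrow> bool" where
  "regular_graph k V E \<longleftrightarrow> (\<forall>v\<in>V. card {u\<in>V. adj E v u} = k)"

definition is_cycle :: "nat set \<Rightarrow> (nat \<times> nat) set \<Rightarrow> nat list \<Rightarrow> bool" where
  "is_cycle V E c \<longleftrightarrow> length c \<ge> 3 \<and> distinct c \<and> set c \<subseteq> V \<and>
     (\<forall>i<length c. adj E (c ! i) (c ! ((i + 1) mod length c)))"

definition girth_at_least :: "nat set \<Rightarrow> (nat \<times> nat) set \<Rightarrow> real \<Rightarrow> bool" where
  "girth_at_least V E b \<longleftrightarrow> (\<forall>c. is_cycle V E c \<longrightarrow> real (length c) \<ge> b)"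

definition p_expander_ineq :: "real \<Rightarrow> real \<Rightarrow> 'a::metric_space itself \<Rightarrow> nat set \<Rightarrow> (nat \<times> nat) set \<Rightarrow> bool" where
  "p_expander_ineq p \<gamma> _ V E \<longleftrightarrow> (\<forall>f :: nat \<Rightarrow> 'a.
     (1 / real (card V) ^ 2) * (\<Sum>u\<in>V. \<Sum>v\<in>V. dist (f u) (f v) powr p)
       \<le> (\<gamma> / real (card E)) * (\<Sum>(u,v)\<in>E. dist (f u) (f v) powr p))"

definition admits_high_girth_expanders ::
  "real \<Rightarrow> 'a::metric_space itself \<Rightarrow> nat \<Rightarrow> real \<Rightarrow> real \<Rightarrow> (nat \<Rightarrow> nat set) \<Rightarrow> (nat \<Rightarrow> (nat \<times> nat) set) \<Rightarrow> bool" where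
  "admits_high_girth_expanders p Y k \<gamma> \<eta> V E \<longleftrightarrow> \<gamma> > 0 \<and> \<eta> > 0 \<and>
     (\<forall>n. simple_graph (V n) (E n) \<and> regular_graph k (V n) (E n)
          \<and> girth_at_least (V n) (E n) (\<eta> * ln (real (card (V n))))
          \<and> p_expander_ineq p \<gamma> Y (V n) (E n))
     \<and> filterlim (\<lambda>n. card (V n)) at_top sequentially"

text \<open>Letter (i, False) is the generator s_(i+1), letter (i, True) is its inverse.\<close>
type_synonym letter = "nat \<times> bool"

definition linv :: "letter \<Rightarrow> letter" where
  "linv a = (fst a, \<not> snd a)"

definition winv :: "letter list \<Rightarrow> letter list" where
  "winv w = rev (map linv w)"

definition gens :: "nat \<Rightarrow> letter set" where
  "gens d = {..<d} \<times> UNIV"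

definition words :: "nat \<Rightarrow> nat \<Rightarrow> letter list set" where
  "words d j = {w. w \<in> lists (gens d) \<and> length w = j}"

inductive pres_eq :: "nat \<Rightarrow> letter list set \<Rightarrow> letter list \<Rightarrow> letter list \<Rightarrow> bool"
  for d :: nat and R :: "letter list set" where
  refl: "x \<in> lists (gens d) \<Longrightarrow> pres_eq d R x x"
| sym: "pres_eq d R x y \<Longrightarrow> pres_eq d R y x"
| trans: "pres_eq d R x y \<Longrightarrow> pres_eq d R y z \<Longrightarrow> pres_eq d R x z"
| cancel: "u \<in> lists (gens d) \<Longrightarrow> v \<in> lists (gens d) \<Longrightarrow> a \<in> gens d \<Longrightarrow>
           pres_eq d R (u @ [a, linv a] @ v) (u @ v)"
| relator: "u \<in> lists (gens d) \<Longrightarrow> v \<in> lists (gens d) \<Longrightarrow> r \<in> R \<Longrightarrow> r \<in> lists (gens d) \<Longrightarrow>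
           pres_eq d R (u @ r @ v) (u @ v)"

definition pres_rel :: "nat \<Rightarrow> letter list set \<Rightarrow> (letter list \<times> letter list) set" where
  "pres_rel d R = {(x, y). pres_eq d R x y}"

definition presented_group :: "nat \<Rightarrow> letter list set \<Rightarrow> letter list set monoid" where
  "presented_group d R =
    \<lparr>carrier = lists (gens d) // pres_rel d R,
     mult = (\<lambda>A B. pres_rel d R `` {(SOME x. x \<in> A) @ (SOME y. y \<in> B)}),
     one = pres_rel d R `` {[]}\<rparr>"

definition traverse_word :: "(nat \<times> nat) set \<Rightarrow> (nat \<times> nat \<Rightarrow> letter list) \<Rightarrow> nat \<Rightarrow> nat \<Rightarrow> letter list" where
  "traverse_word E w u v = (if (u, v) \<in> E then w (u, v) else winv (w (v, u)))"

definition cycle_relator :: "(nat \<times> nat) set \<Rightarrow> (nat \<times> nat \<Rightarrow> letter list) \<Rightarrow> nat list \<Rightarrow> letter list" where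
  "cycle_relator E w c =
     concat (map (\<lambda>i. traverse_word E w (c ! i) (c ! ((i + 1) mod length c))) [0..<length c])"

definition graph_relators :: "nat set \<Rightarrow> (nat \<times> nat) set \<Rightarrow> (nat \<times> nat \<Rightarrow> letter list) \<Rightarrow> letter list set" where
  "graph_relators V E w = {cycle_relator E w c | c. is_cycle V E c}"

definition graph_group :: "nat set \<Rightarrow> (nat \<times> nat) set \<Rightarrow> nat \<Rightarrow> (nat \<times> nat \<Rightarrow> letter list) \<Rightarrow> letter list set monoid" where
  "graph_group V E d w = presented_group d (graph_relators V E w)"

definition isometric_action :: "('g, 'b) monoid_scheme \<Rightarrow> ('g \<Rightarrow> 'a::metric_space \<Rightarrow> 'a) \<Rightarrow> bool" where
  "isometric_action G \<phi> \<longleftrightarrow> \<phi> \<in> hom G (BijGroup (UNIV :: 'a set)) \<and>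
     (\<forall>g\<in>carrier G. \<forall>x y. dist (\<phi> g x) (\<phi> g y) = dist x y)"

definition has_common_fixed_point :: "('g, 'b) monoid_scheme \<Rightarrow> ('g \<Rightarrow> 'a \<Rightarrow> 'a) \<Rightarrow> bool" where
  "has_common_fixed_point G \<phi> \<longleftrightarrow> (\<exists>x. \<forall>g\<in>carrier G. \<phi> g x = x)"

definition fixed_point_property :: "('g, 'b) monoid_scheme \<Rightarrow> 'a::metric_space itself \<Rightarrow> bool" where
  "fixed_point_property G _ \<longleftrightarrow>
     (\<forall>\<phi> :: 'g \<Rightarrow> 'a \<Rightarrow> 'a. isometric_action G \<phi> \<longrightarrow> has_common_fixed_point G \<phi>)"

definition random_group_prob ::
  "nat set \<Rightarrow> (nat \<times> nat) set \<Rightarrow> nat \<Rightarrow> nat \<Rightarrow> (letter list set monoid \<Rightarrow> bool) \<Rightarrow> real" where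
  "random_group_prob V E d j P =
     real (card {w \<in> Pi\<^sub>E E (\<lambda>_. words d j). P (graph_group V E d w)})
     / real (card (Pi\<^sub>E E (\<lambda>_. words d j)))"

end

theory Submission
  imports Defs
begin

text \<open>
  Fix a length \<open>q\<close>. Once the girth exceeds \<open>q\<close>, the non-backtracking walks of length \<open>q\<close> in the
  graph are simple paths, so their words are products of independent uniform words, and by
  Chebyshev's inequality each word of length \<open>jq\<close> labels, with probability tending to 1, at least
  half the expected number of these walks. A point \<open>x\<close> and an action of the random group
  define a map from the vertices to \<open>Y\<close>; as the endpoints of a random non-backtracking walk are
  uniform vertices, the Poincare inequality bounds the \<open>p\<close>-th moment of the displacement of \<open>x\<close>
  under random words of length \<open>jq\<close> by a constant, independent of \<open>q\<close>, times the displacement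
  \<open>D(x)\<close> under the generators. On the other hand, by uniform convexity the minimum over \<open>y\<close> of the
  mean of \<open>d(y, hx)^p\<close> over lazy random words \<open>h\<close> of length \<open>m\<close> increases with \<open>m\<close> by an amount
  that controls the displacement of the minimiser. Since it stays bounded for \<open>m\<close> up to a large
  \<open>n\<close>, some minimiser \<open>y\<close> satisfies \<open>D(y) \<le> D(x)/2\<close> and \<open>d(x,y)^p \<le> C D(x)\<close>; iterating this
  converges to a common fixed point.
\<close>

section \<open>Isometries of uniformly convex spaces\<close>

text \<open>Since a + b is at most twice the maximum. Unlike the sharper 2^(p-1), the constant 2^p
  is valid for every p \<ge> 0.\<close>

lemma powr_add_le_powr:
  fixes a b p :: real
  assumes "0 \<le> a" "0 \<le> b" "0 \<le> p"
  shows "(a + b) powr p \<le> 2 powr p * (a powr p + b powr p)"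
proof -
  have "(a + b) powr p \<le> (2 * max a b) powr p"
    using assms by (intro powr_mono2) auto
  also have "\<dots> = 2 powr p * max a b powr p"
    using assms by (simp add: powr_mult)
  also have "\<dots> \<le> 2 powr p * (a powr p + b powr p)"
    by (intro mult_left_mono) (auto simp: max_def)
  finally show ?thesis .
qed

lemma dist_powr_triangle:
  fixes x y z :: "'a::metric_space"
  assumes "0 \<le> p"
  shows "dist x z powr p \<le> 2 powr p * (dist x y powr p + dist y z powr p)"
proof -
  have "dist x z powr p \<le> (dist x y + dist y z) powr p"
    using assms by (intro powr_mono2) (auto simp: dist_triangle)
  also have "\<dots> \<le> 2 powr p * (dist x y powr p + dist y z powr p)"
    using assms by (intro powr_add_le_powr) auto
  finally show ?thesis .
qed

section \<open>Averaging operators of a finite family of isometries\<close>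

locale isometry_family =
  fixes S :: "'s set" and act :: "'s \<Rightarrow> 'a::metric_space \<Rightarrow> 'a" and p :: real
  assumes finite_S: "finite S" and S_ne: "S \<noteq> {}"
    and isometry: "s \<in> S \<Longrightarrow> dist (act s x) (act s y) = dist x y"
    and p_pos: "0 < p"
begin

text \<open>The Markov operator of the random walk with steps in \<open>S\<close>:
  \<open>(avg ^^ m) u y\<close> is the mean of \<open>u\<close> over the images of \<open>y\<close>
  under all products of \<open>m\<close> members of the family.\<close>

definition avg :: "('a \<Rightarrow> real) \<Rightarrow> 'a \<Rightarrow> real" where
  "avg u y = (\<Sum>s\<in>S. u (act s y)) / real (card S)"

text \<open>Belongs to the walk that stays put with probability 1/2 at each step.\<close>

definition lazy_avg :: "('a \<Rightarrow> real) \<Rightarrow> 'a \<Rightarrow> real" where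
  "lazy_avg u y = (u y + avg u y) / 2"

definition displacement :: "'a \<Rightarrow> real" where
  "displacement x = (\<Sum>s\<in>S. dist x (act s x) powr p) / real (card S)"

text \<open>The centre comes first, so that \<open>pdist x\<close> is the function to which the
  averages are applied.\<close>

abbreviation pdist :: "'a \<Rightarrow> 'a \<Rightarrow> real" where
  "pdist x y \<equiv> dist y x powr p"

lemma card_S_pos: "0 < card S"
  using finite_S S_ne by (simp add: card_gt_0_iff)

lemma avg_le_const:
  assumes "\<And>s. s \<in> S \<Longrightarrow> u (act s y) \<le> b"
  shows "avg u y \<le> b"
proof -
  have "(\<Sum>s\<in>S. u (act s y)) \<le> real (card S) * b"
    using sum_bounded_above[of S "\<lambda>s. u (act s y)" b] assms by simp
  then show ?thesis
    using card_S_pos by (simp add: avg_def field_simps)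
qed

lemma avg_const: "avg (\<lambda>_. b) y = b"
  using card_S_pos by (simp add: avg_def)

lemma avg_linear: "avg (\<lambda>y. r * u y + r' * v y) y = r * avg u y + r' * avg v y"
  by (simp add: avg_def sum.distrib sum_distrib_left add_divide_distrib)

lemma avg_affine_le:
  assumes "\<And>s. s \<in> S \<Longrightarrow> u (act s y) \<le> r * v (act s z) + b"
  shows "avg u y \<le> r * avg v z + b"
proof -
  have "(\<Sum>s\<in>S. u (act s y)) \<le> (\<Sum>s\<in>S. r * v (act s z) + b)"
    using assms by (intro sum_mono)
  also have "\<dots> = r * (\<Sum>s\<in>S. v (act s z)) + real (card S) * b"
    by (simp add: sum.distrib sum_distrib_left)
  finally show ?thesis
    using card_S_pos by (simp add: avg_def field_simps)
qed

lemma displacement_nonneg: "0 \<le> displacement x"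
  by (simp add: displacement_def sum_nonneg)

lemma displacement_ge:
  assumes "s \<in> S"
  shows "dist x (act s x) powr p \<le> real (card S) * displacement x"
proof -
  have "dist x (act s x) powr p \<le> (\<Sum>s\<in>S. dist x (act s x) powr p)"
    using assms finite_S by (intro member_le_sum) auto
  then show ?thesis
    using card_S_pos by (simp add: displacement_def)
qed

lemma displacement_eq_0_imp:
  assumes "displacement x = 0" "s \<in> S"
  shows "act s x = x"
proof -
  have "dist x (act s x) powr p \<le> 0"
    using displacement_ge[OF assms(2), of x] assms(1) by simp
  then show ?thesis by simp
qed

text \<open>Turns the \<open>p\<close>-th moment into one bound for every single step, to which the
  ordinary triangle inequality applies; \<delta> is the \<open>p\<close>-th root of the sum of the
  powers.\<close>

lemma displacement_root:
  obtains \<delta> where "0 \<le> \<delta>" "\<delta> powr p = real (card S) * displacement x"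
    "\<And>s. s \<in> S \<Longrightarrow> dist x (act s x) \<le> \<delta>"
proof
  let ?\<delta> = "(real (card S) * displacement x) powr (1 / p)"
  show "?\<delta> powr p = real (card S) * displacement x"
    using p_pos displacement_nonneg by (simp add: powr_powr)
  show "dist x (act s x) \<le> ?\<delta>" if "s \<in> S" for s
    using powr_mono2[OF _ _ displacement_ge[OF that, of x], of "1 / p"] p_pos
    by (simp add: powr_powr)
qed simp

lemma continuous_displacement: "continuous_on UNIV displacement"
proof -
  have "continuous_on UNIV (act s)" if "s \<in> S" for s
    using that isometry by (auto simp: continuous_on_iff)
  then show ?thesis
    unfolding displacement_def using card_S_pos p_pos
    by (intro continuous_on_divide continuous_on_sum continuous_on_powr' continuous_on_dist
        continuous_on_id continuous_on_const) auto
qed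

text \<open>Apply the same product of isometries to \<open>y\<close> and \<open>z\<close>: their
  distance is unchanged, so the quasi-triangle inequality is used only once, at the end of the walk,
  and the constants do not grow with \<open>m\<close>.\<close>

lemma avg_pow_lipschitz:
  assumes "dist y z \<le> r"
  shows "(avg ^^ m) (pdist x) y \<le> 2 powr p * (avg ^^ m) (pdist x) z + 2 powr p * r powr p"
  using assms
proof (induction m arbitrary: y z)
  case 0
  have "dist y x powr p \<le> 2 powr p * (dist y z powr p + dist z x powr p)"
    using p_pos by (intro dist_powr_triangle) simp
  also have "\<dots> \<le> 2 powr p * (r powr p + dist z x powr p)"
    using 0 p_pos by (intro mult_left_mono add_right_mono powr_mono2) auto
  finally show ?case
    by (simp add: algebra_simps)
next
  case (Suc m)
  have "avg ((avg ^^ m) (pdist x)) y \<le> 2 powr p * avg ((avg ^^ m) (pdist x)) z + 2 powr p * r powr p"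
    by (rule avg_affine_le, rule Suc.IH) (simp add: isometry Suc.prems)
  then show ?case by simp
qed

text \<open>\<open>r\<close> steps move \<open>x\<close> by at most r \<delta>, and isometries keep
  the walk from \<open>y\<close> within \<open>t\<close> of the walk from \<open>x\<close>.\<close>

lemma avg_pow_le_of_ball:
  assumes "\<And>s. s \<in> S \<Longrightarrow> dist x (act s x) \<le> \<delta>"
    and "\<And>z. dist z x \<le> real r * \<delta> + t \<Longrightarrow> u z \<le> b" and "dist y x \<le> t"
  shows "(avg ^^ r) u y \<le> b"
  using assms(2,3)
proof (induction r arbitrary: y t)
  case (Suc r)
  have "avg ((avg ^^ r) u) y \<le> b"
  proof (rule avg_le_const)
    fix s assume s: "s \<in> S"
    have "dist (act s y) x \<le> dist (act s y) (act s x) + dist (act s x) x"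
      by (rule dist_triangle)
    also have "\<dots> \<le> t + \<delta>"
      using s isometry[OF s] Suc.prems(2) assms(1)[OF s] by (simp add: dist_commute)
    finally have "dist (act s y) x \<le> t + \<delta>" .
    then show "(avg ^^ r) u (act s y) \<le> b"
      by (intro Suc.IH[of "t + \<delta>"] Suc.prems(1)) (auto simp: algebra_simps)
  qed
  then show ?case by simp
qed simp

text \<open>The remaining fewer than \<open>j\<close> steps move a point by at most \<open>j\<close> times the largest displacement.\<close>

lemma avg_pow_le_of_multiples:
  assumes j: "0 < j" and B: "0 \<le> B"
    and mult: "(avg ^^ (j * (m div j))) (pdist x) x \<le> B * displacement x"
  shows "(avg ^^ m) (pdist x) x
    \<le> 2 powr p * (B + real j powr p * real (card S)) * displacement x"
proof -
  obtain \<delta> where \<delta>0: "0 \<le> \<delta>" and \<delta>p: "\<delta> powr p = real (card S) * displacement x"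
    and step: "\<And>s. s \<in> S \<Longrightarrow> dist x (act s x) \<le> \<delta>"
    using displacement_root[of x] by blast
  let ?r = "m mod j"
  \<comment> \<open>The outer \<open>avg ^^ ?r\<close> takes the remaining steps first, so they only
    shift the starting point of the long average, which \<open>avg_pow_lipschitz\<close> compares
    with \<open>x\<close>.\<close>
  have "(avg ^^ ?r) ((avg ^^ (j * (m div j))) (pdist x)) x
      \<le> 2 powr p * (B + real j powr p * real (card S)) * displacement x"
  proof (rule avg_pow_le_of_ball[where \<delta> = \<delta> and t = 0, OF step])
    fix z assume z: "dist z x \<le> real ?r * \<delta> + 0"
    have "real ?r * \<delta> \<le> real j * \<delta>"
      using \<delta>0 j by (intro mult_right_mono) (auto intro: less_imp_le)
    with z have "dist z x \<le> real j * \<delta>" by simp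
    then have "(avg ^^ (j * (m div j))) (pdist x) z
        \<le> 2 powr p * (avg ^^ (j * (m div j))) (pdist x) x + 2 powr p * (real j * \<delta>) powr p"
      by (rule avg_pow_lipschitz)
    also have "\<dots> \<le> 2 powr p * (B * displacement x) + 2 powr p * (real j * \<delta>) powr p"
      using mult by (intro add_right_mono mult_left_mono) auto
    also have "\<dots> = 2 powr p * (B + real j powr p * real (card S)) * displacement x"
      using \<delta>0 by (simp add: powr_mult \<delta>p algebra_simps)
    finally show "(avg ^^ (j * (m div j))) (pdist x) z
        \<le> 2 powr p * (B + real j powr p * real (card S)) * displacement x" .
  qed auto
  moreover have "(avg ^^ ?r) ((avg ^^ (j * (m div j))) (pdist x)) = (avg ^^ m) (pdist x)"
    using fun_cong[OF funpow_add[of ?r "j * (m div j)" avg], of "pdist x"] by simp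
  ultimately show ?thesis by simp
qed

lemma lazy_avg_linear: "lazy_avg (\<lambda>y. r * u y + r' * v y) = (\<lambda>y. r * lazy_avg u y + r' * lazy_avg v y)"
  by (rule ext) (simp add: lazy_avg_def avg_linear algebra_simps add_divide_distrib)

lemma lazy_avg_pow_linear:
  "(lazy_avg ^^ n) (\<lambda>y. r * u y + r' * v y)
    = (\<lambda>y. r * (lazy_avg ^^ n) u y + r' * (lazy_avg ^^ n) v y)"
  by (induction n) (simp_all add: lazy_avg_linear)

text \<open>Expanding the \<open>n\<close> lazy steps gives a binomial mean of the values
  \<open>(avg ^^ m) u x\<close> with i \<le> m \<le> i + n. The offset \<open>i\<close> makes the
  induction work, since a lazy step keeps it or raises it by one.\<close>

lemma lazy_avg_pow_le:
  assumes "\<And>m. i \<le> m \<Longrightarrow> m \<le> i + n \<Longrightarrow> (avg ^^ m) u x \<le> b"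
  shows "(lazy_avg ^^ n) ((avg ^^ i) u) x \<le> b"
  using assms
proof (induction n arbitrary: i)
  case (Suc n)
  have eq: "lazy_avg ((avg ^^ i) u) = (\<lambda>y. (1/2) * (avg ^^ i) u y + (1/2) * (avg ^^ Suc i) u y)"
    by (rule ext) (simp add: lazy_avg_def)
  have "(lazy_avg ^^ Suc n) ((avg ^^ i) u) x
      = (1/2) * (lazy_avg ^^ n) ((avg ^^ i) u) x + (1/2) * (lazy_avg ^^ n) ((avg ^^ Suc i) u) x"
    unfolding funpow_Suc_right o_apply eq by (subst lazy_avg_pow_linear) simp
  moreover have "(lazy_avg ^^ n) ((avg ^^ i) u) x \<le> b" "(lazy_avg ^^ n) ((avg ^^ Suc i) u) x \<le> b"
    using Suc.IH[of i] Suc.IH[of "Suc i"] Suc.prems by auto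
  ultimately show ?case by linarith
qed simp

lemma avg_mono: "(\<And>s. s \<in> S \<Longrightarrow> u (act s y) \<le> v (act s z)) \<Longrightarrow> avg u y \<le> avg v z"
  using avg_affine_le[of u y 1 v z 0] by simp

lemma lazy_avg_pow_nonneg: "0 \<le> (lazy_avg ^^ m) (pdist x) y"
proof (induction m arbitrary: y)
  case (Suc m)
  have "0 \<le> avg ((lazy_avg ^^ m) (pdist x)) y"
    using avg_mono[of "\<lambda>_. 0" y "(lazy_avg ^^ m) (pdist x)" y] Suc by (simp add: avg_const)
  then show ?case using Suc[of y] by (simp add: lazy_avg_def[of "(lazy_avg ^^ m) (pdist x)"])
qed simp

text \<open>Makes points with small lazy averages close to each other. It is the triangle inequality
  through \<open>x\<close>, averaged over the same random product applied to \<open>y\<close> and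
  \<open>z\<close>.\<close>

lemma lazy_avg_pow_dist:
  "dist y z powr p \<le> 2 powr p * ((lazy_avg ^^ m) (pdist x) y + (lazy_avg ^^ m) (pdist x) z)"
proof (induction m arbitrary: y z)
  case 0
  show ?case
    using dist_powr_triangle[of p y z x] p_pos by (simp add: dist_commute)
next
  case (Suc m)
  let ?u = "(lazy_avg ^^ m) (pdist x)"
  have "real (card S) * dist y z powr p = (\<Sum>s\<in>S. dist (act s y) (act s z) powr p)"
    by (simp add: isometry)
  also have "\<dots> \<le> (\<Sum>s\<in>S. 2 powr p * (?u (act s y) + ?u (act s z)))"
    by (intro sum_mono Suc)
  also have "\<dots> = real (card S) * (2 powr p * (avg ?u y + avg ?u z))"
    using card_S_pos by (simp add: avg_def sum_distrib_left sum.distrib field_simps)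
  finally have "dist y z powr p \<le> 2 powr p * (avg ?u y + avg ?u z)"
    using card_S_pos by simp
  with Suc[of y z] show ?case
    by (simp add: lazy_avg_def[of ?u] algebra_simps add_divide_distrib)
qed

end

section \<open>Uniformly convex averages and their near-minimisers\<close>

locale uniformly_convex_isometry_family = isometry_family S act p
  for S :: "'s set" and act :: "'s \<Rightarrow> 'a::metric_space \<Rightarrow> 'a" and p :: real +
  fixes c :: real
  assumes geodesic: "geodesic_space TYPE('a)" and c_pos: "0 < c"
    and convex: "geodesic_segment g y (z::'a) \<Longrightarrow> t \<in> {0..1} \<Longrightarrow> dist x (g t) powr p
      \<le> (1 - t) * dist x y powr p + t * dist x z powr p - c * t * (1 - t) * dist y z powr p"
begin

text \<open>Uniform convexity at t = 1/2, where c t (1 - t) = c / 4. With this modulus fixed, the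
  property survives averaging.\<close>

definition midconvex :: "('a \<Rightarrow> real) \<Rightarrow> bool" where
  "midconvex u \<longleftrightarrow> (\<forall>g y z. geodesic_segment g y z \<longrightarrow>
    u (g (1/2)) \<le> (u y + u z) / 2 - c / 4 * dist y z powr p)"

lemma midconvex_pdist: "midconvex (pdist x)"
  unfolding midconvex_def
proof (intro allI impI)
  fix g y z assume "geodesic_segment g y (z::'a)"
  from convex[OF this, of "1/2" x]
  show "pdist x (g (1/2)) \<le> (pdist x y + pdist x z) / 2 - c / 4 * dist y z powr p"
    by (simp add: dist_commute algebra_simps add_divide_distrib)
qed

text \<open>An isometry maps geodesics to geodesics of the same length, so every summand has the
  same convexity modulus.\<close>

lemma midconvex_avg:
  assumes "midconvex u"
  shows "midconvex (avg u)"
  unfolding midconvex_def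
proof (intro allI impI)
  fix g y z assume g: "geodesic_segment g y (z::'a)"
  have "u (act s (g (1/2))) \<le> (u (act s y) + u (act s z)) / 2 - c / 4 * dist y z powr p"
    if s: "s \<in> S" for s
  proof -
    have "geodesic_segment (\<lambda>t. act s (g t)) (act s y) (act s z)"
      using g s by (simp add: geodesic_segment_def isometry)
    then show ?thesis
      using assms s isometry unfolding midconvex_def by metis
  qed
  then have "(\<Sum>s\<in>S. u (act s (g (1/2))))
      \<le> (\<Sum>s\<in>S. (u (act s y) + u (act s z)) / 2 - c / 4 * dist y z powr p)"
    by (intro sum_mono)
  also have "\<dots> = real (card S) * ((avg u y + avg u z) / 2 - c / 4 * dist y z powr p)"
    using card_S_pos
    by (simp add: avg_def sum_subtractf sum.distrib flip: sum_divide_distrib) (simp add: field_simps)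
  finally show "avg u (g (1/2)) \<le> (avg u y + avg u z) / 2 - c / 4 * dist y z powr p"
    using card_S_pos by (simp add: avg_def[of u "g (1/2)"] pos_divide_le_eq mult.commute)
qed

lemma midconvex_lazy_avg_pow: "midconvex ((lazy_avg ^^ m) (pdist x))"
proof (induction m)
  case (Suc m)
  let ?u = "(lazy_avg ^^ m) (pdist x)"
  show ?case
    unfolding midconvex_def
  proof (intro allI impI)
    fix g y z assume g: "geodesic_segment g y (z::'a)"
    have "?u (g (1/2)) \<le> (?u y + ?u z) / 2 - c / 4 * dist y z powr p"
      "avg ?u (g (1/2)) \<le> (avg ?u y + avg ?u z) / 2 - c / 4 * dist y z powr p"
      using g Suc midconvex_avg[OF Suc] by (auto simp: midconvex_def)
    then show "(lazy_avg ^^ Suc m) (pdist x) (g (1/2))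
        \<le> ((lazy_avg ^^ Suc m) (pdist x) y + (lazy_avg ^^ Suc m) (pdist x) z) / 2
          - c / 4 * dist y z powr p"
      by (simp add: lazy_avg_def[of ?u] field_simps)
  qed
qed (simp add: midconvex_pdist)

text \<open>Compare with the midpoint of a geodesic from \<open>y\<close> to \<open>z\<close>, where
  \<open>u\<close> is still at least \<open>M\<close>.\<close>

lemma midconvex_near_minimum:
  assumes "midconvex u" "\<And>z. M \<le> u z" "u y \<le> M + \<epsilon>"
  shows "M - \<epsilon> + c / 2 * dist y z powr p \<le> u z"
proof -
  obtain g where "geodesic_segment g y z"
    using geodesic by (auto simp: geodesic_space_def)
  then have "u (g (1/2)) \<le> (u y + u z) / 2 - c / 4 * dist y z powr p"
    using assms(1) by (auto simp: midconvex_def)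
  with assms(2)[of "g (1/2)"] assms(3) show ?thesis by (simp add: field_simps)
qed

text \<open>Near-minimisers \<open>y m\<close> of the \<open>m\<close>-th lazy average satisfy \<open>act s (y (m + 1)) \<approx> y m\<close> and
  \<open>y (m + 1) \<approx> y m\<close> up to the increment of the minimum; laziness is what excludes the case that
  all generators merely swap \<open>y m\<close> and \<open>y (m + 1)\<close>.\<close>

lemma displacement_decrease:
  assumes n: "0 < n" and B: "0 \<le> B" and Dx: "0 < displacement x"
    and bound: "\<And>m. m \<le> n \<Longrightarrow> (avg ^^ m) (pdist x) x \<le> B * displacement x"
  obtains y where "displacement y \<le> 2 powr p * (4 / c * (B + 2)) / real n * displacement x"
    and "dist x y powr p \<le> 2 powr p * (2 * B + 1) * displacement x"
proof -
  define G where "G m = (lazy_avg ^^ m) (pdist x)" for m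
  define M where "M m = (INF y. G m y)" for m
  \<comment> \<open>Near-minimisers up to \<epsilon> stand in for minimisers. The \<open>n\<close>
    errors 2 \<epsilon> add up to \<open>2 * displacement x\<close>, which is the 2 in
    \<open>B + 2\<close>.\<close>
  define \<epsilon> where "\<epsilon> = displacement x / real n"
  have \<epsilon>: "0 < \<epsilon>" using Dx n by (simp add: \<epsilon>_def)
  have G0: "0 \<le> G m y" for m y by (simp add: G_def lazy_avg_pow_nonneg)
  then have bdd: "bdd_below (range (G m))" for m by (auto intro!: bdd_belowI)
  then have M_le: "M m \<le> G m y" for m y unfolding M_def by (rule cINF_lower) simp
  have "\<exists>y. G m y < M m + \<epsilon>" for m
    using cInf_lessD[of "range (G m)" "M m + \<epsilon>"] \<epsilon> by (auto simp: M_def)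
  then obtain y where y: "\<And>m. G m (y m) < M m + \<epsilon>" by metis
  have Gx: "G m x \<le> B * displacement x" if "m \<le> n" for m
    using lazy_avg_pow_le[of 0 m "pdist x" x] bound that by (simp add: G_def)
  have near: "M m - \<epsilon> + c / 2 * dist (y m) z powr p \<le> G m z" for m z
    using M_le y[of m] midconvex_lazy_avg_pow[of m x, folded G_def]
    by (intro midconvex_near_minimum) (auto intro: less_imp_le)
  \<comment> \<open>The two terms belong to the two halves of a lazy step: staying at
    \<open>y (Suc m)\<close> and moving it by the family.\<close>
  define d where "d m = dist (y m) (y (Suc m)) powr p + avg (pdist (y m)) (y (Suc m))" for m
  \<comment> \<open>Use \<open>near\<close> at \<open>y (Suc m)\<close> and at its images, and
    average the two. One \<epsilon> comes from \<open>near\<close>, the other from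
    \<open>y (Suc m)\<close> being only a near-minimiser.\<close>
  have incr: "M m - 2 * \<epsilon> + c / 4 * d m \<le> M (Suc m)" for m
  proof -
    let ?y = "y (Suc m)"
    have "avg (\<lambda>z. (c / 2) * dist z (y m) powr p + (M m - \<epsilon>)) ?y \<le> avg (G m) ?y"
      using near[of m] by (intro avg_mono) (simp add: dist_commute[of _ "y m"] algebra_simps)
    also have "avg (\<lambda>z. (c / 2) * dist z (y m) powr p + (M m - \<epsilon>)) ?y
        = c / 2 * avg (pdist (y m)) ?y + (M m - \<epsilon>)"
      using avg_linear[of "c/2" "pdist (y m)" 1 "\<lambda>_. M m - \<epsilon>" ?y] by (simp add: avg_const)
    finally have 1: "c / 2 * avg (pdist (y m)) ?y + (M m - \<epsilon>) \<le> avg (G m) ?y" .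
    have "G (Suc m) ?y = (G m ?y + avg (G m) ?y) / 2"
      by (simp add: G_def lazy_avg_def)
    with 1 near[of m ?y] y[of "Suc m"] show ?thesis
      by (simp add: d_def algebra_simps)
  qed
  have "(\<Sum>m<n. c / 4 * d m) \<le> (\<Sum>m<n. M (Suc m) - M m + 2 * \<epsilon>)"
    using incr by (intro sum_mono) (simp add: algebra_simps)
  also have "\<dots> = M n - M 0 + real n * (2 * \<epsilon>)"
    by (simp add: sum.distrib sum_lessThan_telescope)
  also have "\<dots> \<le> (B + 2) * displacement x"
  proof -
    have "0 \<le> M 0" unfolding M_def by (rule cINF_greatest) (auto simp: G0)
    then show ?thesis
      using M_le[of n x] Gx[of n] n by (simp add: \<epsilon>_def algebra_simps)
  qed
  finally have total: "(\<Sum>m<n. c / 4 * d m) \<le> (B + 2) * displacement x" .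
  \<comment> \<open>By pigeonhole: the total is bounded independently of \<open>n\<close>, so some
    term is at most a fraction 1/n of it.\<close>
  have "\<exists>m<n. c / 4 * d m \<le> (B + 2) * displacement x / real n"
  proof (rule ccontr)
    assume "\<not> ?thesis"
    then have "(\<Sum>m<n. (B + 2) * displacement x / real n) < (\<Sum>m<n. c / 4 * d m)"
      using n by (intro sum_strict_mono) (auto simp: not_le)
    with total n show False by simp
  qed
  then obtain m where m: "m < n" and dm: "c / 4 * d m \<le> (B + 2) * displacement x / real n"
    by blast
  have dm': "d m \<le> 4 / c * (B + 2) / real n * displacement x"
    using dm c_pos n by (simp add: field_simps)
  let ?y = "y (Suc m)"
  \<comment> \<open>The point \<open>y m\<close> serves as an intermediate point between
    \<open>?y\<close> and its images.\<close>
  have "displacement ?y = avg (\<lambda>z. dist ?y z powr p) ?y"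
    by (simp add: displacement_def avg_def)
  also have "\<dots> \<le> 2 powr p * avg (pdist (y m)) ?y + 2 powr p * dist (y m) ?y powr p"
  proof (rule avg_affine_le)
    fix s
    show "dist ?y (act s ?y) powr p
        \<le> 2 powr p * pdist (y m) (act s ?y) + 2 powr p * dist (y m) ?y powr p"
      using dist_powr_triangle[of p ?y "act s ?y" "y m"] p_pos
      by (simp add: dist_commute algebra_simps)
  qed
  also have "\<dots> = 2 powr p * d m"
    by (simp add: d_def algebra_simps)
  also have "\<dots> \<le> 2 powr p * (4 / c * (B + 2) / real n * displacement x)"
    using dm' by (intro mult_left_mono) auto
  finally have 1: "displacement ?y \<le> 2 powr p * (4 / c * (B + 2)) / real n * displacement x"
    by simp
  \<comment> \<open>Both \<open>x\<close> and \<open>?y\<close> have a small value of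
    \<open>G (Suc m)\<close>, which bounds their distance by
    \<open>lazy_avg_pow_dist\<close>.\<close>
  have "\<epsilon> \<le> displacement x"
    using n Dx by (simp add: \<epsilon>_def field_simps)
  then have "G (Suc m) ?y \<le> (B + 1) * displacement x"
    using y[of "Suc m"] M_le[of "Suc m" x] Gx[of "Suc m"] m by (simp add: algebra_simps)
  then have "G (Suc m) x + G (Suc m) ?y \<le> (2 * B + 1) * displacement x"
    using Gx[of "Suc m"] m by (simp add: algebra_simps)
  then have "2 powr p * (G (Suc m) x + G (Suc m) ?y) \<le> 2 powr p * ((2 * B + 1) * displacement x)"
    by (intro mult_left_mono) auto
  then have 2: "dist x ?y powr p \<le> 2 powr p * (2 * B + 1) * displacement x"
    using lazy_avg_pow_dist[of x ?y "Suc m" x, folded G_def] unfolding mult.assoc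
    by (rule order_trans[rotated])
  show thesis using that[OF 1 2] .
qed

end

section \<open>Iteration towards a common fixed point\<close>

text \<open>The choice of \<open>n\<close> makes \<open>displacement_decrease\<close> halve the
  displacement at the cost of a move whose \<open>p\<close>-th power is at most a multiple of it.
  Iterating gives a Cauchy sequence, and by continuity its limit has displacement 0. The bound is
  assumed at all points because the base point changes at each iteration.\<close>

lemma common_fixed_point_of_bounded_moments:
  fixes S :: "'s set" and act :: "'s \<Rightarrow> 'a::complete_space \<Rightarrow> 'a"
  assumes "uniformly_convex_isometry_family S act p c"
    and B: "0 \<le> B" and n: "0 < n" "2 powr p * (4 / c * (B + 2)) / real n \<le> 1 / 2"
    and bound: "\<And>m x. m \<le> n \<Longrightarrow> (isometry_family.avg S act ^^ m) (\<lambda>y. dist y x powr p) x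
      \<le> B * isometry_family.displacement S act p x"
  shows "\<exists>x. \<forall>s\<in>S. act s x = x"
proof -
  interpret uniformly_convex_isometry_family S act p c by fact
  define K where "K = 2 powr p * (2 * B + 1)"
  have K: "0 \<le> K" using B by (simp add: K_def)
  have "\<exists>y. displacement y \<le> displacement x / 2 \<and> dist x y powr p \<le> K * displacement x" for x
  proof (cases "displacement x = 0")
    case True
    then show ?thesis by (intro exI[of _ x]) simp
  next
    case False
    then have Dx: "0 < displacement x" using displacement_nonneg[of x] by simp
    obtain y where y: "displacement y \<le> 2 powr p * (4 / c * (B + 2)) / real n * displacement x"
      "dist x y powr p \<le> K * displacement x"
      using displacement_decrease[OF n(1) B Dx bound] unfolding K_def by blast
    have "2 powr p * (4 / c * (B + 2)) / real n * displacement x \<le> 1 / 2 * displacement x"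
      using n(2) Dx by (intro mult_right_mono) auto
    then have "displacement y \<le> 1 / 2 * displacement x"
      using y(1) by (rule order_trans[rotated])
    with y(2) show ?thesis by (intro exI[of _ y]) simp
  qed
  then obtain nxt where nxt: "\<And>x. displacement (nxt x) \<le> displacement x / 2"
    "\<And>x. dist x (nxt x) powr p \<le> K * displacement x"
    by metis
  \<comment> \<open>Here \<open>undefined\<close> is just an arbitrary starting point.\<close>
  define x where "x i = (nxt ^^ i) undefined" for i
  have D: "displacement (x i) \<le> displacement (x 0) * (1/2) ^ i" for i
  proof (induction i)
    case (Suc i)
    then show ?case using nxt(1)[of "x i"] by (simp add: x_def)
  qed simp
  \<comment> \<open>As the displacement halves each time, the lengths of the moves are bounded by a
    geometric sequence whose ratio is the \<open>p\<close>-th root of 1/2.\<close>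
  define r where "r = (1/2::real) powr (1/p)"
  have r: "0 < r" "r < 1"
    using p_pos powr_less_mono2[of "1/p" "1/2" 1] by (simp_all add: r_def)
  define L where "L = (K * displacement (x 0)) powr (1/p)"
  have dist_x: "dist (x i) (x (Suc i)) \<le> L * r ^ i" for i
  proof -
    have "dist (x i) (x (Suc i)) powr p \<le> K * (displacement (x 0) * (1/2) ^ i)"
      using nxt(2)[of "x i"] mult_left_mono[OF D[of i] K] by (simp add: x_def)
    then have "(dist (x i) (x (Suc i)) powr p) powr (1/p)
        \<le> (K * (displacement (x 0) * (1/2) ^ i)) powr (1/p)"
      using p_pos by (intro powr_mono2) auto
    also have "\<dots> = L * ((1/2) ^ i) powr (1/p)"
      using K displacement_nonneg by (simp add: L_def powr_mult mult.assoc)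
    also have "((1/2::real) ^ i) powr (1/p) = ((1/2) powr real i) powr (1/p)"
      by (simp add: powr_realpow)
    also have "\<dots> = r powr real i"
      unfolding r_def powr_powr by (simp only: mult.commute)
    also have "\<dots> = r ^ i"
      using r by (simp add: powr_realpow)
    finally show ?thesis using p_pos by (simp add: powr_powr)
  qed
  have L0: "0 \<le> L" by (simp add: L_def)
  have "Cauchy x"
  proof (rule metric_CauchyI)
    fix e :: real assume e: "0 < e"
    have tail: "dist (x i) (x (i + l)) \<le> L / (1 - r) * r ^ i" for i l
    proof -
      have "dist (x i) (x (i + l)) \<le> L * r ^ i * (1 - r ^ l) / (1 - r)"
      proof (induction l)
        case (Suc l)
        have "dist (x i) (x (i + Suc l)) \<le> dist (x i) (x (i + l)) + dist (x (i + l)) (x (Suc (i + l)))"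
          using dist_triangle by simp
        also have "\<dots> \<le> L * r ^ i * (1 - r ^ l) / (1 - r) + L * r ^ (i + l)"
          using Suc dist_x by (intro add_mono)
        also have "\<dots> = L * r ^ i * (1 - r ^ Suc l) / (1 - r)"
          using r by (simp add: field_simps power_add)
        finally show ?case .
      qed simp
      also have "\<dots> \<le> L * r ^ i * 1 / (1 - r)"
        using r L0 by (intro divide_right_mono mult_left_mono) auto
      finally show ?thesis by simp
    qed
    have "(\<lambda>i. L / (1 - r) * r ^ i) \<longlonglongrightarrow> L / (1 - r) * 0"
      using r by (intro tendsto_intros LIMSEQ_realpow_zero) auto
    then have "eventually (\<lambda>i. L / (1 - r) * r ^ i < e / 2) sequentially"
      using e by (intro order_tendstoD(2)[of _ 0]) auto
    then obtain N where N: "L / (1 - r) * r ^ N < e / 2"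
      by (auto simp: eventually_sequentially)
    have "dist (x N) (x i) < e / 2" if "N \<le> i" for i
    proof -
      have "dist (x N) (x i) \<le> L / (1 - r) * r ^ N"
        using tail[of N "i - N"] that by simp
      then show ?thesis using N by (rule le_less_trans)
    qed
    then show "\<exists>M. \<forall>m\<ge>M. \<forall>n\<ge>M. dist (x m) (x n) < e"
      by (intro exI[of _ N] allI impI) (rule dist_triangle_half_r)
  qed
  then obtain z where z: "x \<longlonglongrightarrow> z"
    using Cauchy_convergent_iff convergent_def by blast
  have "(\<lambda>i. displacement (x i)) \<longlonglongrightarrow> displacement z"
    using continuous_displacement z by (auto intro: continuous_on_tendsto_compose)
  moreover have "(\<lambda>i. displacement (x i)) \<longlonglongrightarrow> 0"
  proof (rule tendsto_sandwich[where f = "\<lambda>_. 0"])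
    show "(\<lambda>i. displacement (x 0) * (1/2) ^ i) \<longlonglongrightarrow> 0"
      by (intro tendsto_mult_right_zero LIMSEQ_realpow_zero) auto
    show "\<forall>\<^sub>F i in sequentially. displacement (x i) \<le> displacement (x 0) * (1/2) ^ i"
      using D by simp
    show "\<forall>\<^sub>F i in sequentially. 0 \<le> displacement (x i)"
      using displacement_nonneg by simp
  qed auto
  ultimately have "displacement z = 0"
    by (rule LIMSEQ_unique)
  then show ?thesis
    using displacement_eq_0_imp by blast
qed

section \<open>Actions of graph groups\<close>

lemma linv_linv [simp]: "linv (linv a) = a"
  by (simp add: linv_def)

lemma linv_in_gens [simp]: "linv a \<in> gens d \<longleftrightarrow> a \<in> gens d"
  by (cases a) (auto simp: linv_def gens_def)

lemma winv_Nil [simp]: "winv [] = []"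
  by (simp add: winv_def)

lemma winv_Cons: "winv (a # u) = winv u @ [linv a]"
  by (simp add: winv_def)

lemma winv_append [simp]: "winv (u @ v) = winv v @ winv u"
  by (simp add: winv_def)

lemma winv_winv [simp]: "winv (winv u) = u"
  by (induction u) (simp_all add: winv_Cons)

lemma winv_in_lists [simp]: "winv u \<in> lists (gens d) \<longleftrightarrow> u \<in> lists (gens d)"
  by (induction u) (auto simp: winv_Cons)

lemma winv_in_words [simp]: "winv u \<in> words d j \<longleftrightarrow> u \<in> words d j"
proof -
  have "length (winv u) = length u" by (simp add: winv_def)
  then show ?thesis by (simp add: words_def)
qed

lemma finite_gens: "finite (gens d)"
  by (simp add: gens_def)

lemma card_gens: "card (gens d) = 2 * d"
  by (simp add: gens_def card_cartesian_product)

lemma words_eq: "words d j = {w. set w \<subseteq> gens d \<and> length w = j}"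
  by (auto simp: words_def)

lemma finite_words: "finite (words d j)"
  unfolding words_eq by (rule finite_lists_length_eq) (rule finite_gens)

lemma card_words: "card (words d j) = (2 * d) ^ j"
  unfolding words_eq by (subst card_lists_length_eq) (simp_all add: finite_gens card_gens)

lemma words_0: "words d 0 = {[]}"
  by (auto simp: words_def)

lemma words_Suc: "words d (Suc m) = (\<lambda>(a, h). a # h) ` (gens d \<times> words d m)"
proof -
  have "w \<in> (\<lambda>(a, h). a # h) ` (gens d \<times> words d m)" if "w \<in> words d (Suc m)" for w
    using that by (cases w) (auto simp: words_def)
  then show ?thesis by (auto simp: words_def)
qed

section \<open>Multiplication in a presented group\<close>

lemma pres_eq_lists: "pres_eq d R x y \<Longrightarrow> x \<in> lists (gens d) \<and> y \<in> lists (gens d)"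
  by (induction rule: pres_eq.induct) auto

lemma pres_eq_context:
  assumes "pres_eq d R x y" "u \<in> lists (gens d)" "v \<in> lists (gens d)"
  shows "pres_eq d R (u @ x @ v) (u @ y @ v)"
  using assms
proof (induction rule: pres_eq.induct)
  case (refl x)
  then show ?case by (intro pres_eq.refl) auto
next
  case (sym x y)
  then show ?case by (auto intro: pres_eq.sym)
next
  case (trans x y z)
  then show ?case by (auto intro: pres_eq.trans)
next
  case (cancel u' v' a)
  then show ?case using pres_eq.cancel[of "u @ u'" d "v' @ v" a R] by auto
next
  case (relator u' v' r)
  then show ?case using pres_eq.relator[of "u @ u'" d "v' @ v" r R] by auto
qed

lemma pres_eq_append:
  assumes "pres_eq d R x x'" "pres_eq d R y y'"
  shows "pres_eq d R (x @ y) (x' @ y')"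
  using pres_eq_context[OF assms(1), of "[]" y] pres_eq_context[OF assms(2), of x' "[]"]
    pres_eq_lists[OF assms(1)] pres_eq_lists[OF assms(2)]
  by (auto intro: pres_eq.trans)

lemma pres_class_eq: "pres_eq d R x y \<Longrightarrow> pres_rel d R `` {x} = pres_rel d R `` {y}"
  by (auto simp: pres_rel_def intro: pres_eq.trans pres_eq.sym)

text \<open>The product is defined through representatives chosen by \<open>SOME\<close>; as
  \<open>pres_eq\<close> is a congruence, all representatives give the same class.\<close>

lemma mult_presented_group:
  assumes "u \<in> lists (gens d)" "v \<in> lists (gens d)"
  shows "pres_rel d R `` {u} \<otimes>\<^bsub>presented_group d R\<^esub> pres_rel d R `` {v} = pres_rel d R `` {u @ v}"
proof -
  have some: "pres_eq d R z (SOME x. x \<in> pres_rel d R `` {z})" if "z \<in> lists (gens d)" for z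
    using someI[of "\<lambda>x. x \<in> pres_rel d R `` {z}" z] pres_eq.refl[OF that, of R]
    by (auto simp: pres_rel_def)
  show ?thesis
    using pres_class_eq[OF pres_eq_append[OF some[OF assms(1)] some[OF assms(2)]]]
    by (simp add: presented_group_def)
qed

lemma carrier_presented_group:
  "carrier (presented_group d R) = (\<lambda>u. pres_rel d R `` {u}) ` lists (gens d)"
  by (auto simp: presented_group_def quotient_def)

section \<open>Actions of a presented group, word by word\<close>

locale presented_action =
  fixes d :: nat and R :: "letter list set" and \<phi> :: "letter list set \<Rightarrow> 'a::metric_space \<Rightarrow> 'a"
  assumes action: "isometric_action (presented_group d R) \<phi>"
begin

text \<open>Lifts the action from classes to words, where it can be computed letter by letter. It is
  meaningful on words in \<open>lists (gens d)\<close>.\<close>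

definition word_act :: "letter list \<Rightarrow> 'a \<Rightarrow> 'a" where
  "word_act u = \<phi> (pres_rel d R `` {u})"

lemma word_act_Bij: "u \<in> lists (gens d) \<Longrightarrow> word_act u \<in> Bij UNIV"
  using action unfolding isometric_action_def word_act_def
  by (auto simp: hom_def Pi_def BijGroup_def carrier_presented_group)

lemma word_act_append:
  assumes "u \<in> lists (gens d)" "v \<in> lists (gens d)"
  shows "word_act (u @ v) y = word_act u (word_act v y)"
proof -
  have "word_act (u @ v) = word_act u \<otimes>\<^bsub>BijGroup UNIV\<^esub> word_act v"
    using action assms unfolding isometric_action_def word_act_def
    by (auto simp: hom_def carrier_presented_group simp flip: mult_presented_group)
  also have "\<dots> = compose UNIV (word_act u) (word_act v)"
    using word_act_Bij[OF assms(1)] word_act_Bij[OF assms(2)] by (simp add: BijGroup_def)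
  finally show ?thesis by (simp add: compose_def)
qed

text \<open>An idempotent injective map is the identity.\<close>

lemma word_act_Nil: "word_act [] y = y"
proof -
  have "word_act [] (word_act [] y) = word_act [] y"
    using word_act_append[of "[]" "[]" y] by simp
  moreover have "inj (word_act [])"
    using word_act_Bij[of "[]"] by (auto simp: Bij_def bij_betw_def)
  ultimately show ?thesis by (auto dest: injD)
qed

lemma word_act_Cons:
  "a \<in> gens d \<Longrightarrow> u \<in> lists (gens d) \<Longrightarrow> word_act (a # u) y = word_act [a] (word_act u y)"
  using word_act_append[of "[a]" u y] by simp

lemma word_act_relator: "r \<in> R \<Longrightarrow> r \<in> lists (gens d) \<Longrightarrow> word_act r y = y"
  using pres_class_eq[OF pres_eq.relator[of "[]" d "[]" r R]] word_act_Nil[of y]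
  by (simp add: word_act_def)

text \<open>The inner factors \<open>u\<close> and \<open>winv u\<close> cancel by induction,
  leaving \<open>[a, linv a]\<close>, which is trivial by the rule \<open>cancel\<close>.\<close>

lemma word_act_winv:
  assumes "u \<in> lists (gens d)"
  shows "word_act u (word_act (winv u) y) = y"
  using assms
proof (induction u arbitrary: y)
  case (Cons a u)
  then have a: "a \<in> gens d" and u: "u \<in> lists (gens d)" by auto
  have "word_act (a # u) (word_act (winv (a # u)) y)
      = word_act [a] (word_act u (word_act (winv u) (word_act [linv a] y)))"
    using a u by (simp add: winv_Cons word_act_append word_act_Cons[of a u])
  also have "\<dots> = word_act [a, linv a] y"
    using a u word_act_append[of "[a]" "[linv a]"] by (simp add: Cons.IH)
  also have "\<dots> = y"
    using pres_class_eq[OF pres_eq.cancel[of "[]" d "[]" a R]] a word_act_Nil[of y]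
    by (simp add: word_act_def)
  finally show ?case .
qed (simp add: word_act_Nil)

lemma dist_word_act: "u \<in> lists (gens d) \<Longrightarrow> dist (word_act u x) (word_act u y) = dist x y"
  using action by (auto simp: isometric_action_def word_act_def carrier_presented_group)

lemma dist_word_act_le:
  assumes "\<And>a. a \<in> gens d \<Longrightarrow> dist x (word_act [a] x) \<le> \<delta>" "h \<in> lists (gens d)"
  shows "dist x (word_act h x) \<le> real (length h) * \<delta>"
  using assms(2)
proof (induction h)
  case (Cons a h)
  then have a: "a \<in> gens d" and h: "h \<in> lists (gens d)" by auto
  have "dist x (word_act (a # h) x)
      \<le> dist x (word_act [a] x) + dist (word_act [a] x) (word_act (a # h) x)"
    by (rule dist_triangle)
  also have "\<dots> = dist x (word_act [a] x) + dist x (word_act h x)"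
    using a h by (simp add: word_act_Cons[OF a h] dist_word_act)
  also have "\<dots> \<le> \<delta> + real (length h) * \<delta>"
    using assms(1)[OF a] Cons.IH by (rule add_mono)
  finally show ?case by (simp add: algebra_simps)
qed (simp add: word_act_Nil)

lemma common_fixed_pointI:
  assumes "\<And>a. a \<in> gens d \<Longrightarrow> word_act [a] x = x"
  shows "has_common_fixed_point (presented_group d R) \<phi>"
proof -
  have "word_act u x = x" if "u \<in> lists (gens d)" for u
    using that
  proof (induction u)
    case (Cons a u)
    then show ?case using word_act_Cons[of a u x] assms by simp
  qed (simp add: word_act_Nil)
  then show ?thesis
    by (auto simp: has_common_fixed_point_def carrier_presented_group word_act_def)
qed

lemma isometry_family_gens:
  assumes "0 < d" "0 < p"
  shows "isometry_family (gens d) (\<lambda>a. word_act [a]) p"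
  using assms by unfold_locales (auto simp: finite_gens dist_word_act gens_def)

text \<open>Links the averages to counts of words. The first letter of a word acts last, so
  prepending a letter replaces \<open>u\<close> by \<open>avg u\<close>; hence the induction is over
  all \<open>u\<close>.\<close>

lemma avg_pow_eq_sum_words:
  fixes p :: real
  assumes "0 < d" "0 < p"
  shows "(isometry_family.avg (gens d) (\<lambda>a. word_act [a]) ^^ m) u y
    = (\<Sum>h\<in>words d m. u (word_act h y)) / real (2 * d) ^ m"
proof -
  interpret isometry_family "gens d" "\<lambda>a. word_act [a]" p
    by (rule isometry_family_gens[OF assms])
  show ?thesis
  proof (induction m arbitrary: u)
    case 0
    then show ?case by (simp add: words_0 word_act_Nil)
  next
    case (Suc m)
    have "(\<Sum>h\<in>words d (Suc m). u (word_act h y))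
        = (\<Sum>(a, h)\<in>gens d \<times> words d m. u (word_act (a # h) y))"
      unfolding words_Suc by (subst sum.reindex) (auto simp: inj_on_def case_prod_beta)
    also have "\<dots> = (\<Sum>a\<in>gens d. \<Sum>h\<in>words d m. u (word_act [a] (word_act h y)))"
      unfolding sum.cartesian_product[symmetric]
      by (auto intro!: sum.cong word_act_Cons arg_cong[where f = u] simp: words_def)
    also have "\<dots> = (\<Sum>h\<in>words d m. \<Sum>a\<in>gens d. u (word_act [a] (word_act h y)))"
      by (rule sum.swap)
    also have "\<dots> = (\<Sum>h\<in>words d m. real (2 * d) * avg u (word_act h y))"
      using assms(1) by (simp add: avg_def card_gens)
    finally show ?case
      using assms(1) Suc[of "avg u"]
      by (simp add: funpow_swap1 sum_distrib_left[symmetric])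
  qed
qed

end

section \<open>Walks in a graph and the words along them\<close>

fun walk_word :: "(nat \<times> nat) set \<Rightarrow> (nat \<times> nat \<Rightarrow> letter list) \<Rightarrow> nat list \<Rightarrow> letter list" where
  "walk_word E w (x # y # xs) = traverse_word E w x y @ walk_word E w (y # xs)"
| "walk_word E w xs = []"

definition is_walk :: "nat set \<Rightarrow> (nat \<times> nat) set \<Rightarrow> nat list \<Rightarrow> bool" where
  "is_walk V E xs \<longleftrightarrow> xs \<noteq> [] \<and> set xs \<subseteq> V \<and> successively (adj E) xs"

lemma adj_commute: "adj E u v \<longleftrightarrow> adj E v u"
  by (auto simp: adj_def)

lemma is_walk_rev [simp]: "is_walk V E (rev xs) \<longleftrightarrow> is_walk V E xs"
  by (simp add: is_walk_def adj_commute)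

lemma is_walk_append:
  "is_walk V E (xs @ [y] @ ys) \<longleftrightarrow> is_walk V E (xs @ [y]) \<and> is_walk V E (y # ys)"
  by (auto simp: is_walk_def successively_append_iff successively_Cons)

lemma walk_word_append:
  "walk_word E w (xs @ [y] @ ys) = walk_word E w (xs @ [y]) @ walk_word E w (y # ys)"
  by (induction E w xs rule: walk_word.induct) auto

lemma walk_word_conv_nth:
  "walk_word E w xs = concat (map (\<lambda>i. traverse_word E w (xs ! i) (xs ! Suc i)) [0..<length xs - 1])"
proof (induction E w xs rule: walk_word.induct)
  case (1 E w x y xs)
  have "[0..<length (x # y # xs) - 1] = 0 # map Suc [0..<length (y # xs) - 1]"
    by (simp add: upt_conv_Cons map_Suc_upt del: upt_Suc)
  then show ?case using 1 by (simp add: o_def)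
qed auto

text \<open>A cycle lists every vertex once and closes up modulo its length; the corresponding
  closed walk repeats its first vertex at the end.\<close>

lemma cycle_relator_eq_walk_word:
  assumes "c \<noteq> []"
  shows "cycle_relator E w c = walk_word E w (c @ [hd c])"
proof -
  have "(c @ [hd c]) ! Suc i = c ! ((i + 1) mod length c)" "(c @ [hd c]) ! i = c ! i"
    if "i < length c" for i
    using that assms by (auto simp: nth_append hd_conv_nth mod_Suc)
  then show ?thesis
    unfolding cycle_relator_def walk_word_conv_nth by (auto intro!: arg_cong[where f = concat])
qed

lemma is_cycle_iff_walk:
  assumes "c \<noteq> []"
  shows "is_cycle V E c \<longleftrightarrow> 3 \<le> length c \<and> distinct c \<and> is_walk V E (c @ [hd c])"
proof -
  have "(c @ [hd c]) ! Suc i = c ! ((i + 1) mod length c)" "(c @ [hd c]) ! i = c ! i"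
    if "i < length c" for i
    using that assms by (auto simp: nth_append hd_conv_nth mod_Suc)
  then show ?thesis
    using assms by (auto simp: is_cycle_def is_walk_def successively_conv_nth)
qed

lemma walk_word_in_lists:
  assumes "successively (adj E) xs" "\<And>e. e \<in> E \<Longrightarrow> w e \<in> lists (gens d)"
  shows "walk_word E w xs \<in> lists (gens d)"
  using assms
proof (induction E w xs rule: walk_word.induct)
  case (1 E w x y xs)
  then have "traverse_word E w x y \<in> lists (gens d)"
    by (auto simp: traverse_word_def adj_def)
  moreover have "walk_word E w (y # xs) \<in> lists (gens d)" using 1 by auto
  ultimately show ?case by simp
qed auto

text \<open>An edge is stored in one orientation only, with its smaller vertex first, so both
  directions of travel use the same label.\<close>

lemma traverse_word_rev:
  assumes "simple_graph V E" "adj E u v"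
  shows "traverse_word E w v u = winv (traverse_word E w u v)"
proof -
  have "a < b" if "(a, b) \<in> E" for a b
    using assms(1) that by (auto simp: simple_graph_def)
  then have "(u, v) \<in> E \<Longrightarrow> (v, u) \<notin> E"
    by (meson less_asym)
  then show ?thesis
    using assms(2) by (auto simp: traverse_word_def adj_def)
qed

lemma walk_word_rev:
  assumes "simple_graph V E" "successively (adj E) xs"
  shows "walk_word E w (rev xs) = winv (walk_word E w xs)"
  using assms
proof (induction E w xs rule: walk_word.induct)
  case (1 E w x y xs)
  have "walk_word E w (rev (x # y # xs)) = walk_word E w (rev xs @ [y] @ [x])" by simp
  also have "\<dots> = walk_word E w (rev (y # xs)) @ walk_word E w [y, x]"
    by (subst walk_word_append) simp
  finally show ?case using 1 by (auto simp: traverse_word_rev)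
qed auto

section \<open>Closed walks and the potential of a point\<close>

locale graph_action = presented_action d "graph_relators V E w" \<phi>
  for d :: nat and V :: "nat set" and E :: "(nat \<times> nat) set" and w :: "nat \<times> nat \<Rightarrow> letter list"
    and \<phi> :: "letter list set \<Rightarrow> 'a::metric_space \<Rightarrow> 'a" +
  assumes graph: "simple_graph V E" and w_lists: "e \<in> E \<Longrightarrow> w e \<in> lists (gens d)"
begin

lemma walk_word_lists: "is_walk V E xs \<Longrightarrow> walk_word E w xs \<in> lists (gens d)"
  by (rule walk_word_in_lists) (auto simp: is_walk_def w_lists)

lemma not_adj_self: "\<not> adj E x x"
  using graph by (auto simp: simple_graph_def adj_def)

text \<open>A closed walk that repeats a vertex before its end splits into two shorter closed walks;
  otherwise it is a backtracking step or one of the cycles that define the relators.\<close>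

lemma word_act_closed_walk:
  assumes "is_walk V E xs" "hd xs = last xs"
  shows "word_act (walk_word E w xs) y = y"
  using assms
proof (induction "length xs" arbitrary: xs y rule: less_induct)
  case less
  show ?case
  proof (cases "distinct (butlast xs)")
    case False
    then obtain as v bs cs where "butlast xs = as @ [v] @ bs @ [v] @ cs"
      using not_distinct_decomp by blast
    moreover have "xs = butlast xs @ [last xs]" using less.prems by (simp add: is_walk_def)
    \<comment> \<open>\<open>cs'\<close> contains at least the last vertex of \<open>xs\<close>, so
      the closed walk from \<open>v\<close> to \<open>v\<close> is strictly shorter than
      \<open>xs\<close>; so is the walk with this loop cut out.\<close>
    ultimately obtain cs' where cs': "cs' \<noteq> []" and xs: "xs = as @ [v] @ bs @ [v] @ cs'"
      by (metis append.assoc append_is_Nil_conv not_Cons_self2)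
    have walks: "is_walk V E (as @ [v])" "is_walk V E (v # bs @ [v])" "is_walk V E (v # cs')"
      using less.prems(1) is_walk_append[of V E as v "bs @ [v] @ cs'"]
        is_walk_append[of V E "v # bs" v cs'] by (auto simp: xs)
    have short: "is_walk V E (as @ [v] @ cs')"
      using walks is_walk_append[of V E as v cs'] by simp
    have "walk_word E w xs
        = walk_word E w (as @ [v]) @ walk_word E w (v # bs @ [v]) @ walk_word E w (v # cs')"
      using walk_word_append[of E w as v "bs @ [v] @ cs'"]
        walk_word_append[of E w "v # bs" v cs'] by (simp add: xs)
    then have "word_act (walk_word E w xs) y = word_act (walk_word E w (as @ [v]))
        (word_act (walk_word E w (v # bs @ [v])) (word_act (walk_word E w (v # cs')) y))"
      using walks by (simp add: word_act_append walk_word_lists)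
    also have "word_act (walk_word E w (v # bs @ [v])) (word_act (walk_word E w (v # cs')) y)
        = word_act (walk_word E w (v # cs')) y"
      using walks cs' by (intro less.hyps) (auto simp: xs)
    also have "word_act (walk_word E w (as @ [v])) (word_act (walk_word E w (v # cs')) y)
        = word_act (walk_word E w (as @ [v] @ cs')) y"
      unfolding walk_word_append[of E w as v cs']
      using walks by (simp add: word_act_append walk_word_lists)
    also have "\<dots> = y"
      using short less.prems(2) cs' by (intro less.hyps) (auto simp: xs hd_append)
    finally show ?thesis .
  next
    case True
    define c where "c = butlast xs"
    show ?thesis
    proof (cases "c = []")
      case True
      then have "length xs \<le> 1" by (cases xs) (auto simp: c_def split: if_splits)
      then have "walk_word E w xs = []" by (cases xs) auto
      then show ?thesis by (simp add: word_act_Nil)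
    next
      case False
      then have xs: "xs = c @ [hd c]"
        using less.prems by (cases xs) (auto simp: c_def is_walk_def split: if_splits)
      consider u where "c = [u]" | u v where "c = [u, v]" | "3 \<le> length c"
        using False by (cases c rule: remdups_adj.cases) (auto simp: Suc_le_eq)
      then show ?thesis
      proof cases
        case 1
        then show ?thesis using less.prems(1) not_adj_self by (auto simp: xs is_walk_def)
      next
        case 2
        then have "adj E u v" using less.prems(1) by (auto simp: xs is_walk_def)
        then have "walk_word E w xs = traverse_word E w u v @ winv (traverse_word E w u v)"
          using 2 graph by (simp add: xs traverse_word_rev)
        moreover have "traverse_word E w u v \<in> lists (gens d)"
          using walk_word_lists[of "[u, v]"] less.prems(1) 2
          by (auto simp: xs is_walk_def)
        ultimately show ?thesis
          by (simp add: word_act_append word_act_winv)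
      next
        case 3
        then have "is_cycle V E c"
          using False less.prems(1) True by (simp add: is_cycle_iff_walk xs flip: c_def)
        then have "walk_word E w xs \<in> graph_relators V E w"
          unfolding graph_relators_def xs cycle_relator_eq_walk_word[OF False, symmetric] by blast
        then show ?thesis
          using walk_word_lists[OF less.prems(1)] by (rule word_act_relator)
      qed
    qed
  qed
qed

lemma is_walk_concat:
  assumes "is_walk V E xs" "is_walk V E ys" "last xs = hd ys"
  shows "is_walk V E (xs @ tl ys)" "walk_word E w (xs @ tl ys) = walk_word E w xs @ walk_word E w ys"
    "hd (xs @ tl ys) = hd xs" "last (xs @ tl ys) = last ys"
proof -
  obtain as y where xs: "xs = as @ [y]"
    using assms(1) by (cases xs rule: rev_exhaust) (auto simp: is_walk_def)
  obtain y' bs where "ys = y' # bs"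
    using assms(2) by (cases ys) (auto simp: is_walk_def)
  with xs assms(3) have ys: "ys = y # bs" by simp
  show "is_walk V E (xs @ tl ys)"
    using assms is_walk_append[of V E as y bs] by (simp add: xs ys)
  show "walk_word E w (xs @ tl ys) = walk_word E w xs @ walk_word E w ys"
    using walk_word_append[of E w as y bs] by (simp add: xs ys)
  show "hd (xs @ tl ys) = hd xs" "last (xs @ tl ys) = last ys"
    by (simp_all add: xs ys hd_append)
qed

text \<open>As closed walks act trivially, the image of \<open>x\<close> along a path from a base
  vertex depends only on where the path ends. The images at the two ends of \<open>xs\<close> are
  then one isometry applied to \<open>x\<close> and to its image under the word of
  \<open>xs\<close>.\<close>

lemma potential_exists:
  obtains f :: "nat \<Rightarrow> 'a"
  where "\<And>xs. is_walk V E xs \<Longrightarrow>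
    dist (f (hd xs)) (f (last xs)) = dist x (word_act (walk_word E w xs) x)"
proof -
  \<comment> \<open>The graph need not be connected. A base vertex is chosen from the set
    \<open>component v\<close> alone, so vertices joined by a walk share it.\<close>
  define component where "component v = {u. \<exists>xs. is_walk V E xs \<and> hd xs = u \<and> last xs = v}" for v
  define base where "base v = (SOME u. u \<in> component v)" for v
  define path where "path v = (SOME xs. is_walk V E xs \<and> hd xs = base v \<and> last xs = v)" for v
  define f where "f v = word_act (walk_word E w (path v)) x" for v
  have path: "is_walk V E (path v)" "hd (path v) = base v" "last (path v) = v" if "v \<in> V" for v
  proof -
    have "v \<in> component v"
      using that by (auto simp: component_def is_walk_def intro!: exI[of _ "[v]"])
    then have "base v \<in> component v" unfolding base_def by (rule someI)
    then show "is_walk V E (path v)" "hd (path v) = base v" "last (path v) = v"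
      unfolding path_def component_def
      using someI_ex[of "\<lambda>xs. is_walk V E xs \<and> hd xs = base v \<and> last xs = v"]
      by auto
  qed
  show thesis
  proof (rule that[of f])
    fix xs assume xs: "is_walk V E xs"
    define u v where "u = hd xs" and "v = last xs"
    have uv: "u \<in> V" "v \<in> V" using xs by (auto simp: is_walk_def u_def v_def)
    have component_mono: "component (hd zs) \<subseteq> component (last zs)" if zs: "is_walk V E zs" for zs
    proof
      fix t assume "t \<in> component (hd zs)"
      then obtain ys where "is_walk V E ys" "hd ys = t" "last ys = hd zs"
        by (auto simp: component_def)
      then have "is_walk V E (ys @ tl zs)" "hd (ys @ tl zs) = t" "last (ys @ tl zs) = last zs"
        using is_walk_concat[OF _ zs, of ys] by auto
      then show "t \<in> component (last zs)" unfolding component_def by blast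
    qed
    have "component u = component v"
      using component_mono[OF xs] component_mono[of "rev xs"] xs
      by (simp add: u_def v_def hd_rev last_rev)
    then have base: "base u = base v" by (simp add: base_def)
    \<comment> \<open>The closed walk goes from the base vertex along \<open>path u\<close>, then
      along \<open>xs\<close>, and back along the reverse of \<open>path v\<close>.\<close>
    let ?p = "path u @ tl xs"
    note p = is_walk_concat[OF path(1)[OF uv(1)] xs, unfolded path(3)[OF uv(1)], OF u_def]
    have r: "is_walk V E (rev (path v))" "last ?p = hd (rev (path v))"
      using path[OF uv(2)] p(4) by (auto simp: hd_rev v_def)
    note c = is_walk_concat[OF p(1) r]
    have "walk_word E w (?p @ tl (rev (path v)))
        = walk_word E w (path u) @ walk_word E w xs @ winv (walk_word E w (path v))"
      using c(2) p(2) walk_word_rev[OF graph] path(1)[OF uv(2)] by (simp add: is_walk_def)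
    moreover have "hd (?p @ tl (rev (path v))) = last (?p @ tl (rev (path v)))"
      using c(3,4) p(3) path[OF uv(1)] path[OF uv(2)] base by (simp add: last_rev)
    ultimately have "word_act (walk_word E w (path u) @ walk_word E w xs
        @ winv (walk_word E w (path v))) (f v) = f v"
      using word_act_closed_walk[OF c(1)] by simp
    moreover have "word_act (winv (walk_word E w (path v))) (f v) = x"
      using word_act_winv[of "winv (walk_word E w (path v))" x] walk_word_lists[OF path(1)[OF uv(2)]]
      by (simp add: f_def)
    ultimately have "f v = word_act (walk_word E w (path u)) (word_act (walk_word E w xs) x)"
      using walk_word_lists[OF path(1)[OF uv(1)]] walk_word_lists[OF path(1)[OF uv(2)]]
        walk_word_lists[OF xs]
      by (simp add: word_act_append)
    then show "dist (f (hd xs)) (f (last xs)) = dist x (word_act (walk_word E w xs) x)"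
      using walk_word_lists[OF path(1)[OF uv(1)]]
      by (simp add: f_def[of u] dist_word_act flip: u_def v_def)
  qed
qed

end

section \<open>Non-backtracking walks\<close>

definition nonbacktracking :: "'b list \<Rightarrow> bool" where
  "nonbacktracking xs \<longleftrightarrow> (\<forall>i. i + 2 < length xs \<longrightarrow> xs ! i \<noteq> xs ! (i + 2))"

definition nb_walks :: "nat set \<Rightarrow> (nat \<times> nat) set \<Rightarrow> nat \<Rightarrow> nat list set" where
  "nb_walks V E q = {xs. is_walk V E xs \<and> length xs = Suc q \<and> nonbacktracking xs}"

text \<open>The number of non-backtracking walks with \<open>q\<close> edges and a given end in a
  \<open>k\<close>-regular graph: \<open>k\<close> choices for the first step, \<open>k - 1\<close>
  for each later one.\<close>

definition nb_count :: "nat \<Rightarrow> nat \<Rightarrow> nat" where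
  "nb_count k q = (if q = 0 then 1 else k * (k - 1) ^ (q - 1))"

lemma nonbacktracking_rev: "nonbacktracking (rev xs) \<longleftrightarrow> nonbacktracking xs"
proof -
  have *: "nonbacktracking (rev ys)" if ys: "nonbacktracking ys" for ys :: "'a list"
    unfolding nonbacktracking_def
  proof (intro allI impI)
    fix i assume i: "i + 2 < length (rev ys)"
    define l where "l = length ys - Suc (i + 2)"
    have "ys ! l \<noteq> ys ! (l + 2)"
      using ys i by (auto simp: nonbacktracking_def l_def)
    moreover have "rev ys ! i = ys ! (l + 2)" "rev ys ! (i + 2) = ys ! l"
      using i by (auto simp: rev_nth l_def intro!: arg_cong[where f = "(!) ys"])
    ultimately show "rev ys ! i \<noteq> rev ys ! (i + 2)" by simp
  qed
  show ?thesis using *[of xs] *[of "rev xs"] by auto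
qed

lemma nonbacktracking_Cons:
  "nonbacktracking (x # xs) \<longleftrightarrow> (1 < length xs \<longrightarrow> x \<noteq> xs ! 1) \<and> nonbacktracking xs"
  (is "?l \<longleftrightarrow> ?r")
proof
  assume l: ?l
  have "xs ! i \<noteq> xs ! (i + 2)" if "i + 2 < length xs" for i
    using l[unfolded nonbacktracking_def, rule_format, of "Suc i"] that by simp
  moreover have "x \<noteq> xs ! 1" if "1 < length xs"
    using l[unfolded nonbacktracking_def, rule_format, of 0] that by simp
  ultimately show ?r by (auto simp: nonbacktracking_def)
next
  assume r: ?r
  show ?l
    unfolding nonbacktracking_def
  proof (intro allI impI)
    fix i assume "i + 2 < length (x # xs)"
    then show "(x # xs) ! i \<noteq> (x # xs) ! (i + 2)"
      using r by (cases i) (auto simp: nonbacktracking_def)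
  qed
qed

lemma rev_in_nb_walks: "xs \<in> nb_walks V E q \<Longrightarrow> rev xs \<in> nb_walks V E q"
  by (simp add: nb_walks_def nonbacktracking_rev)

lemma finite_nb_walks: "finite V \<Longrightarrow> finite (nb_walks V E q)"
  by (rule finite_subset[OF _ finite_lists_length_eq[of V "Suc q"]])
    (auto simp: nb_walks_def is_walk_def)

lemma nb_walks_Suc_Cons:
  assumes "xs \<noteq> []"
  shows "x # xs \<in> nb_walks V E (Suc q) \<longleftrightarrow> xs \<in> nb_walks V E q \<and> x \<in> V \<and> adj E (hd xs) x
    \<and> (0 < q \<longrightarrow> x \<noteq> xs ! 1)"
  using assms
  by (cases xs) (auto simp: nb_walks_def is_walk_def nonbacktracking_Cons adj_commute[of E x])

text \<open>Walks are extended at the front. The new vertex is any neighbour of the head except the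
  second vertex, which is itself a neighbour and so removes exactly one choice.\<close>

lemma card_nb_walks_last:
  assumes V: "finite V" and reg: "regular_graph k V E" and v: "v \<in> V"
  shows "card {xs \<in> nb_walks V E q. last xs = v} = nb_count k q"
proof (induction q)
  case 0
  have "{xs \<in> nb_walks V E 0. last xs = v} = {[v]}"
  proof (intro equalityI subsetI)
    fix xs assume "xs \<in> {xs \<in> nb_walks V E 0. last xs = v}"
    then show "xs \<in> {[v]}" by (cases xs) (auto simp: nb_walks_def)
  qed (use v in \<open>auto simp: nb_walks_def is_walk_def nonbacktracking_def\<close>)
  then show ?case by (simp add: nb_count_def)
next
  case (Suc q)
  let ?P = "{xs \<in> nb_walks V E q. last xs = v}"
  let ?ext = "\<lambda>xs. {x \<in> V. adj E (hd xs) x} - (if q = 0 then {} else {xs ! 1})"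
  have ne: "xs \<noteq> []" if "xs \<in> nb_walks V E q" for xs and q
    using that by (auto simp: nb_walks_def)
  have "{xs \<in> nb_walks V E (Suc q). last xs = v} = (\<lambda>(xs, x). x # xs) ` Sigma ?P ?ext"
  proof (intro equalityI subsetI)
    fix ys assume ys: "ys \<in> {xs \<in> nb_walks V E (Suc q). last xs = v}"
    then have len: "length ys = Suc (Suc q)" by (simp add: nb_walks_def)
    then obtain x y zs where "ys = x # y # zs"
      by (auto simp: length_Suc_conv)
    then obtain x xs where ys': "ys = x # xs" "xs \<noteq> []" by blast
    then have "(xs, x) \<in> Sigma ?P ?ext"
      using ys by (auto simp: nb_walks_Suc_Cons)
    then show "ys \<in> (\<lambda>(xs, x). x # xs) ` Sigma ?P ?ext"
      using ys' by (intro image_eqI[of _ _ "(xs, x)"]) auto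
  next
    fix ys assume "ys \<in> (\<lambda>(xs, x). x # xs) ` Sigma ?P ?ext"
    then obtain xs x where "ys = x # xs" "xs \<in> ?P" "x \<in> ?ext xs" by auto
    then show "ys \<in> {xs \<in> nb_walks V E (Suc q). last xs = v}"
      using ne[of xs q] by (auto simp: nb_walks_Suc_Cons split: if_splits)
  qed
  moreover have "inj_on (\<lambda>(xs, x). x # xs) (Sigma ?P ?ext)" by (auto simp: inj_on_def)
  ultimately have "card {xs \<in> nb_walks V E (Suc q). last xs = v} = card (Sigma ?P ?ext)"
    by (simp add: card_image)
  also have "\<dots> = (\<Sum>xs\<in>?P. card (?ext xs))"
    using finite_nb_walks[OF V] V by (intro card_SigmaI) auto
  also have "\<dots> = (\<Sum>xs\<in>?P. if q = 0 then k else k - 1)"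
  proof (rule sum.cong)
    fix xs assume xs: "xs \<in> ?P"
    then have hd: "hd xs \<in> V" by (cases xs) (auto simp: nb_walks_def is_walk_def)
    then have k: "card {x \<in> V. adj E (hd xs) x} = k"
      using reg by (simp add: regular_graph_def)
    show "card (?ext xs) = (if q = 0 then k else k - 1)"
    proof (cases q)
      case (Suc q')
      then obtain a b r where "xs = a # b # r"
        using xs by (cases xs rule: remdups_adj.cases) (auto simp: nb_walks_def)
      then have "xs ! 1 \<in> {x \<in> V. adj E (hd xs) x}"
        using xs by (auto simp: nb_walks_def is_walk_def)
      then show ?thesis using Suc k by simp
    qed (use k in simp)
  qed simp
  also have "\<dots> = nb_count k (Suc q)"
    using Suc by (cases q) (auto simp: nb_count_def)
  finally show ?case .
qed

text \<open>Sort the walks by their last vertex: every vertex ends the same number of them.\<close>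

lemma sum_nb_walks_last:
  fixes g :: "nat \<Rightarrow> real"
  assumes V: "finite V" and reg: "regular_graph k V E"
  shows "(\<Sum>xs\<in>nb_walks V E q. g (last xs)) = real (nb_count k q) * (\<Sum>v\<in>V. g v)"
proof -
  have "(\<Sum>xs\<in>nb_walks V E q. g (last xs))
      = (\<Sum>v\<in>V. \<Sum>xs\<in>{xs \<in> nb_walks V E q. last xs = v}. g (last xs))"
  proof (rule sum.group[symmetric])
    show "last ` nb_walks V E q \<subseteq> V" by (auto simp: nb_walks_def is_walk_def)
  qed (simp_all add: finite_nb_walks V)
  also have "\<dots> = (\<Sum>v\<in>V. \<Sum>xs\<in>{xs \<in> nb_walks V E q. last xs = v}. g v)"
    by (intro sum.cong) auto
  finally show ?thesis
    by (simp add: card_nb_walks_last[OF V reg] sum_distrib_left)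
qed

lemma sum_nb_walks_hd:
  fixes g :: "nat \<Rightarrow> real"
  assumes V: "finite V" and reg: "regular_graph k V E"
  shows "(\<Sum>xs\<in>nb_walks V E q. g (hd xs)) = real (nb_count k q) * (\<Sum>v\<in>V. g v)"
proof -
  have "(\<Sum>xs\<in>nb_walks V E q. g (hd xs)) = (\<Sum>xs\<in>nb_walks V E q. g (last xs))"
    by (rule sum.reindex_bij_witness[of _ rev rev])
      (auto simp: rev_in_nb_walks last_rev)
  then show ?thesis by (simp add: sum_nb_walks_last[OF assms])
qed

lemma card_nb_walks:
  assumes "finite V" "regular_graph k V E"
  shows "real (card (nb_walks V E q)) = real (nb_count k q) * real (card V)"
  using sum_nb_walks_last[OF assms, of "\<lambda>_. 1" q] by simp

text \<open>Both endpoints of a uniformly random non-backtracking walk are uniformly distributed, so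
  comparing them with an independent uniform vertex bounds the energy along such walks, with a
  constant that does not depend on their length.\<close>

lemma sum_nb_walks_dist_le:
  fixes f :: "nat \<Rightarrow> 'a::metric_space"
  assumes V: "finite V" and reg: "regular_graph k V E" and p: "0 \<le> p"
  shows "real (card V) * (\<Sum>xs\<in>nb_walks V E q. dist (f (hd xs)) (f (last xs)) powr p)
    \<le> 2 powr p * (2 * real (nb_count k q)) * (\<Sum>u\<in>V. \<Sum>v\<in>V. dist (f u) (f v) powr p)"
proof -
  define g where "g u = (\<Sum>v\<in>V. dist (f u) (f v) powr p)" for u
  have "real (card V) * dist (f (hd xs)) (f (last xs)) powr p
      \<le> 2 powr p * (g (hd xs) + g (last xs))" for xs
  proof -
    have "(\<Sum>v\<in>V. dist (f (hd xs)) (f (last xs)) powr p)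
        \<le> (\<Sum>v\<in>V. 2 powr p * (dist (f (hd xs)) (f v) powr p + dist (f (last xs)) (f v) powr p))"
      using dist_powr_triangle[OF p, of "f (hd xs)" "f (last xs)"]
      by (intro sum_mono) (simp add: dist_commute[of "f (last xs)"])
    also have "\<dots> = 2 powr p * (g (hd xs) + g (last xs))"
      by (simp add: g_def sum.distrib flip: sum_distrib_left)
    finally show ?thesis by simp
  qed
  then have "(\<Sum>xs\<in>nb_walks V E q. real (card V) * dist (f (hd xs)) (f (last xs)) powr p)
      \<le> (\<Sum>xs\<in>nb_walks V E q. 2 powr p * (g (hd xs) + g (last xs)))"
    by (intro sum_mono)
  also have "\<dots> = 2 powr p * ((\<Sum>xs\<in>nb_walks V E q. g (hd xs)) + (\<Sum>xs\<in>nb_walks V E q. g (last xs)))"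
    by (simp add: sum.distrib flip: sum_distrib_left)
  also have "\<dots> = 2 powr p * (2 * real (nb_count k q)) * (\<Sum>u\<in>V. g u)"
    by (simp add: sum_nb_walks_hd[OF V reg] sum_nb_walks_last[OF V reg])
  finally show ?thesis by (simp add: g_def sum_distrib_left)
qed

section \<open>Walks below the girth and their words\<close>

text \<open>Take a repetition at the smallest distance \<open>l\<close> along the walk. For l = 1 it
  would be a loop, for l = 2 a backtracking step, and for l \<ge> 3 the piece in between is a cycle
  of length l \<le> q, below the girth.\<close>

lemma nb_walk_distinct:
  assumes graph: "simple_graph V E" and girth: "\<And>c. is_cycle V E c \<Longrightarrow> q < length c"
    and xs: "xs \<in> nb_walks V E q"
  shows "distinct xs"
proof (rule ccontr)
  assume "\<not> distinct xs"
  define rep where "rep l \<longleftrightarrow> 0 < l \<and> (\<exists>i. i + l < length xs \<and> xs ! i = xs ! (i + l))" for l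
  have "\<exists>l. rep l"
  proof -
    obtain a b where ab: "a < length xs" "b < length xs" "a \<noteq> b" "xs ! a = xs ! b"
      using \<open>\<not> distinct xs\<close> by (auto simp: distinct_conv_nth)
    then have "rep (max a b - min a b)"
      unfolding rep_def by (intro conjI exI[of _ "min a b"]) (auto simp: max_def min_def)
    then show ?thesis ..
  qed
  then obtain l where l: "rep l" and l_min: "\<And>m. m < l \<Longrightarrow> \<not> rep m"
    using exists_least_iff[of rep] by auto
  then obtain i where i: "0 < l" "i + l < length xs" "xs ! i = xs ! (i + l)"
    by (auto simp: rep_def)
  have adj: "adj E (xs ! a) (xs ! Suc a)" if "Suc a < length xs" for a
    using xs that by (auto simp: nb_walks_def is_walk_def successively_conv_nth)
  have "l \<noteq> 1"
    using i adj[of i] graph by (auto simp: adj_def simple_graph_def)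
  moreover have "l \<noteq> 2"
    using i xs by (auto simp: nb_walks_def nonbacktracking_def)
  ultimately have l3: "3 \<le> l" using i by linarith
  define c where "c = take l (drop i xs)"
  have len: "length c = l" using i by (simp add: c_def)
  have nth: "c ! a = xs ! (i + a)" if "a < l" for a
    using that i by (simp add: c_def)
  have c: "c \<noteq> []" using len i by auto
  have hd: "hd c = xs ! (i + l)"
    using nth[of 0] i c by (simp add: hd_conv_nth)
  have "distinct c"
  proof (rule ccontr)
    assume "\<not> distinct c"
    then obtain a b where ab: "a < l" "b < l" "a \<noteq> b" "c ! a = c ! b"
      by (auto simp: distinct_conv_nth len)
    then have "rep (max a b - min a b)"
      unfolding rep_def using i nth
      by (intro conjI exI[of _ "i + min a b"]) (auto simp: max_def min_def)
    then show False using l_min[of "max a b - min a b"] ab by linarith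
  qed
  moreover have "is_walk V E (c @ [hd c])"
  proof -
    have eq: "c @ [hd c] = take (Suc l) (drop i xs)"
      using i by (simp add: c_def[symmetric] hd take_Suc_conv_app_nth)
    have "set (take (Suc l) (drop i xs)) \<subseteq> V"
      using xs by (auto simp: nb_walks_def is_walk_def dest!: in_set_takeD in_set_dropD)
    moreover have "successively (adj E) (take (Suc l) (drop i xs))"
      using adj i by (auto simp: successively_conv_nth)
    ultimately show ?thesis unfolding is_walk_def eq using c eq by auto
  qed
  ultimately have "is_cycle V E c"
    using c l3 len by (simp add: is_cycle_iff_walk)
  then show False
    using girth[of c] len i xs by (simp add: nb_walks_def)
qed

text \<open>The pair under which an edge is stored, hence the argument at which its label is looked
  up.\<close>

definition or_edge :: "(nat \<times> nat) set \<Rightarrow> nat \<Rightarrow> nat \<Rightarrow> nat \<times> nat" where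
  "or_edge E u v = (if (u, v) \<in> E then (u, v) else (v, u))"

fun walk_edges :: "(nat \<times> nat) set \<Rightarrow> nat list \<Rightarrow> (nat \<times> nat) set" where
  "walk_edges E (x # y # xs) = insert (or_edge E x y) (walk_edges E (y # xs))"
| "walk_edges E xs = {}"

lemma walk_edges_vertices: "walk_edges E xs \<subseteq> set xs \<times> set xs"
  by (induction E xs rule: walk_edges.induct) (auto simp: or_edge_def)

lemma or_edge_notin_walk_edges: "x \<notin> set ys \<Longrightarrow> or_edge E x y \<notin> walk_edges E ys"
  using walk_edges_vertices[of E ys] by (auto simp: or_edge_def)

lemma walk_edges_subset: "successively (adj E) xs \<Longrightarrow> walk_edges E xs \<subseteq> E"
  by (induction E xs rule: walk_edges.induct) (auto simp: or_edge_def adj_def)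

lemma finite_walk_edges: "finite (walk_edges E xs)"
  by (induction E xs rule: walk_edges.induct) auto

text \<open>Each edge starts at a vertex that does not recur in the rest of the walk, so no edge is
  repeated.\<close>

lemma card_walk_edges: "distinct xs \<Longrightarrow> card (walk_edges E xs) = length xs - 1"
proof (induction E xs rule: walk_edges.induct)
  case (1 E x y xs)
  then show ?case
    using or_edge_notin_walk_edges[of x "y # xs" E y] by (simp add: finite_walk_edges)
qed auto

text \<open>All labels have length \<open>j\<close>, so \<open>h\<close> splits into blocks of
  length \<open>j\<close>, each of which determines the label of one edge. The edges are distinct
  because the vertices are, so the prescriptions never conflict.\<close>

lemma walk_word_eq_iff:
  assumes "distinct xs" "successively (adj E) xs" "h \<in> words d (j * (length xs - 1))"
  shows "\<exists>c. (\<forall>e\<in>walk_edges E xs. c e \<in> words d j) \<and>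
    (\<forall>w. (\<forall>e\<in>E. w e \<in> words d j) \<longrightarrow>
      (walk_word E w xs = h \<longleftrightarrow> (\<forall>e\<in>walk_edges E xs. w e = c e)))"
  using assms
proof (induction E xs arbitrary: h rule: walk_edges.induct)
  case (1 E x y xs)
  define h1 h2 where "h1 = take j h" and "h2 = drop j h"
  have h: "h = h1 @ h2" by (simp add: h1_def h2_def)
  have len: "length h = j + j * length xs" using 1 by (simp add: words_def)
  have h1: "h1 \<in> words d j" and h2: "h2 \<in> words d (j * (length (y # xs) - 1))"
    using 1 len by (auto simp: words_def h1_def h2_def dest: in_set_takeD in_set_dropD)
  obtain c where c: "\<forall>e\<in>walk_edges E (y # xs). c e \<in> words d j"
    "\<And>w. \<forall>e\<in>E. w e \<in> words d j \<Longrightarrow>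
      walk_word E w (y # xs) = h2 \<longleftrightarrow> (\<forall>e\<in>walk_edges E (y # xs). w e = c e)"
    using 1(1)[of h2] 1(2,3) h2 by auto
  let ?e = "or_edge E x y"
  \<comment> \<open>An edge traversed against its orientation contributes the inverse of its
    label.\<close>
  define c' where "c' = c(?e := if (x, y) \<in> E then h1 else winv h1)"
  have notin: "?e \<notin> walk_edges E (y # xs)"
    using 1(2) by (intro or_edge_notin_walk_edges) simp
  have "walk_word E w (x # y # xs) = h \<longleftrightarrow> (\<forall>e\<in>walk_edges E (x # y # xs). w e = c' e)"
    if w: "\<forall>e\<in>E. w e \<in> words d j" for w
  proof -
    have "?e \<in> E" using 1(3) by (auto simp: or_edge_def adj_def)
    then have "traverse_word E w x y \<in> words d j"
      using w by (auto simp: traverse_word_def or_edge_def split: if_splits)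
    then have "walk_word E w (x # y # xs) = h
        \<longleftrightarrow> traverse_word E w x y = h1 \<and> walk_word E w (y # xs) = h2"
      using h1 by (simp add: h words_def append_eq_append_conv)
    also have "traverse_word E w x y = h1 \<longleftrightarrow> w ?e = c' ?e"
      by (auto simp: traverse_word_def or_edge_def c'_def)
    also have "walk_word E w (y # xs) = h2 \<longleftrightarrow> (\<forall>e\<in>walk_edges E (y # xs). w e = c' e)"
      unfolding c(2)[OF w] using notin by (intro ball_cong) (auto simp: c'_def)
    finally show ?thesis by simp
  qed
  moreover have "\<forall>e\<in>walk_edges E (x # y # xs). c' e \<in> words d j"
    using c(1) h1 by (auto simp: c'_def)
  ultimately show ?case by blast
qed (auto simp: words_def intro!: exI)

text \<open>Independence of the labels in counting form: fixing the labels on \<open>F\<close>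
  leaves those on \<open>E - F\<close> free.\<close>

lemma card_PiE_prescribed:
  assumes E: "finite E" and F: "F \<subseteq> E" and c: "\<And>e. e \<in> F \<Longrightarrow> c e \<in> W" and W: "finite W" "W \<noteq> {}"
  shows "real (card {w \<in> Pi\<^sub>E E (\<lambda>_. W). \<forall>e\<in>F. w e = c e})
    = real (card (Pi\<^sub>E E (\<lambda>_. W))) / real (card W) ^ card F"
proof -
  have "{w \<in> Pi\<^sub>E E (\<lambda>_. W). \<forall>e\<in>F. w e = c e} = Pi\<^sub>E E (\<lambda>e. if e \<in> F then {c e} else W)"
    using F c unfolding set_eq_iff mem_Collect_eq PiE_iff by (auto split: if_splits)
  then have "card {w \<in> Pi\<^sub>E E (\<lambda>_. W). \<forall>e\<in>F. w e = c e}
      = (\<Prod>e\<in>E. if e \<in> F then 1 else card W)"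
    using E by (simp add: card_PiE if_distrib cong: if_cong)
  also have "\<dots> = card W ^ card (E - F)"
    using E F by (subst prod.If_cases) (auto simp: Diff_eq)
  also have "card (E - F) = card E - card F"
    using F E by (intro card_Diff_subset) (auto intro: finite_subset)
  finally have "real (card {w \<in> Pi\<^sub>E E (\<lambda>_. W). \<forall>e\<in>F. w e = c e})
      = real (card W) ^ (card E - card F)" by simp
  also have "\<dots> = real (card W) ^ card E / real (card W) ^ card F"
    using E F W by (intro power_diff) (auto simp: card_mono)
  finally show ?thesis
    using E by (simp add: card_PiE)
qed

section \<open>The second moment method\<close>

text \<open>Chebyshev's inequality in counting form. Indicators have covariance 0 for pairs outside
  \<open>dep\<close> and at most 1 for the others, of which each \<open>x\<close> has at most
  \<open>R\<close>; every exceptional \<open>w\<close> deviates from the mean by more than half of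
  it.\<close>

lemma second_moment_bound:
  fixes \<Omega> :: "'w set" and P :: "'p set" and A :: "'w \<Rightarrow> 'p \<Rightarrow> bool" and a R :: real
  assumes fin: "finite \<Omega>" "finite P" and a: "0 < a"
    and single: "\<And>x. x \<in> P \<Longrightarrow> real (card {w \<in> \<Omega>. A w x}) = a * real (card \<Omega>)"
    and pair: "\<And>x y. x \<in> P \<Longrightarrow> y \<in> P \<Longrightarrow> \<not> dep x y \<Longrightarrow>
      real (card {w \<in> \<Omega>. A w x \<and> A w y}) = a\<^sup>2 * real (card \<Omega>)"
    and R: "0 \<le> R" and dep: "\<And>x. x \<in> P \<Longrightarrow> real (card {y \<in> P. dep x y}) \<le> R"
  shows "real (card {w \<in> \<Omega>. real (card {x \<in> P. A w x}) < a * real (card P) / 2})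
    * (a\<^sup>2 * real (card P)) \<le> 4 * R * real (card \<Omega>)"
proof (cases "P = {}")
  case False
  define ind where "ind w x = (if A w x then 1 else 0 :: real)" for w x
  have ind_sum: "(\<Sum>w\<in>\<Omega>. ind w x) = a * real (card \<Omega>)" if "x \<in> P" for x
    using single[OF that] fin by (simp add: ind_def sum.If_cases Int_def)
  have ind_prod: "(\<Sum>w\<in>\<Omega>. ind w x * ind w y) = real (card {w \<in> \<Omega>. A w x \<and> A w y})" for x y
  proof -
    have "(\<Sum>w\<in>\<Omega>. ind w x * ind w y) = (\<Sum>w\<in>\<Omega>. if A w x \<and> A w y then 1 else 0)"
      by (intro sum.cong) (auto simp: ind_def)
    then show ?thesis using fin by (simp add: sum.If_cases Int_def)
  qed
  define cnt where "cnt w = real (card {x \<in> P. A w x})" for w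
  have cnt: "cnt w = (\<Sum>x\<in>P. ind w x)" for w
    using fin by (simp add: cnt_def ind_def sum.If_cases Int_def)
  let ?\<mu> = "a * real (card P)"
  let ?n = "real (card \<Omega>)"
  have cov: "(\<Sum>w\<in>\<Omega>. (ind w x - a) * (ind w y - a)) \<le> (if dep x y then ?n else 0)"
    if xy: "x \<in> P" "y \<in> P" for x y
  proof -
    have "(\<Sum>w\<in>\<Omega>. (ind w x - a) * (ind w y - a))
        = (\<Sum>w\<in>\<Omega>. ind w x * ind w y) - a * (\<Sum>w\<in>\<Omega>. ind w x) - a * (\<Sum>w\<in>\<Omega>. ind w y) + a\<^sup>2 * ?n"
      by (simp add: algebra_simps sum.distrib sum_subtractf sum_distrib_left power2_eq_square)
    also have "\<dots> = real (card {w \<in> \<Omega>. A w x \<and> A w y}) - a\<^sup>2 * ?n"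
      using xy by (simp add: ind_sum ind_prod power2_eq_square)
    also have "\<dots> \<le> (if dep x y then ?n else 0)"
    proof (cases "dep x y")
      case True
      have "real (card {w \<in> \<Omega>. A w x \<and> A w y}) \<le> ?n"
        using fin by (intro of_nat_mono card_mono) auto
      moreover have "0 \<le> a\<^sup>2 * ?n" by simp
      ultimately show ?thesis unfolding if_P[OF True] by linarith
    qed (use pair xy in simp)
    finally show ?thesis .
  qed
  have "(\<Sum>w\<in>\<Omega>. (cnt w - ?\<mu>)\<^sup>2) = (\<Sum>w\<in>\<Omega>. \<Sum>x\<in>P. \<Sum>y\<in>P. (ind w x - a) * (ind w y - a))"
  proof (rule sum.cong)
    fix w
    have "cnt w - ?\<mu> = (\<Sum>x\<in>P. ind w x - a)" by (simp add: cnt sum_subtractf)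
    then show "(cnt w - ?\<mu>)\<^sup>2 = (\<Sum>x\<in>P. \<Sum>y\<in>P. (ind w x - a) * (ind w y - a))"
      by (simp add: power2_eq_square sum_product)
  qed simp
  also have "\<dots> = (\<Sum>x\<in>P. \<Sum>w\<in>\<Omega>. \<Sum>y\<in>P. (ind w x - a) * (ind w y - a))"
    by (rule sum.swap)
  also have "\<dots> = (\<Sum>x\<in>P. \<Sum>y\<in>P. \<Sum>w\<in>\<Omega>. (ind w x - a) * (ind w y - a))"
    by (intro sum.cong sum.swap) simp
  also have "\<dots> \<le> (\<Sum>x\<in>P. \<Sum>y\<in>P. if dep x y then ?n else 0)"
    by (intro sum_mono cov)
  also have "\<dots> = (\<Sum>x\<in>P. real (card {y \<in> P. dep x y}) * ?n)"
    using fin by (intro sum.cong) (auto simp: sum.If_cases Int_def)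
  also have "\<dots> \<le> (\<Sum>x\<in>P. R * ?n)"
    by (intro sum_mono mult_right_mono dep) auto
  finally have var: "(\<Sum>w\<in>\<Omega>. (cnt w - ?\<mu>)\<^sup>2) \<le> real (card P) * (R * ?n)" by simp
  let ?bad = "{w \<in> \<Omega>. cnt w < ?\<mu> / 2}"
  have "real (card ?bad) * (?\<mu> / 2)\<^sup>2 = (\<Sum>w\<in>?bad. (?\<mu> / 2)\<^sup>2)" by simp
  also have "\<dots> \<le> (\<Sum>w\<in>?bad. (cnt w - ?\<mu>)\<^sup>2)"
  proof (rule sum_mono)
    fix w assume "w \<in> ?bad"
    then have "?\<mu> / 2 \<le> ?\<mu> - cnt w" by simp
    then have "(?\<mu> / 2)\<^sup>2 \<le> (?\<mu> - cnt w)\<^sup>2"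
      using a by (intro power_mono) auto
    then show "(?\<mu> / 2)\<^sup>2 \<le> (cnt w - ?\<mu>)\<^sup>2" by (simp add: power2_commute)
  qed
  also have "\<dots> \<le> (\<Sum>w\<in>\<Omega>. (cnt w - ?\<mu>)\<^sup>2)"
    using fin by (intro sum_mono2) auto
  finally have "real (card P) * (real (card ?bad) * (a\<^sup>2 * real (card P)))
      \<le> real (card P) * (4 * R * ?n)"
    using var by (simp add: power2_eq_square algebra_simps)
  moreover have "0 < real (card P)" using False fin by (simp add: card_gt_0_iff)
  ultimately show ?thesis unfolding cnt_def by (simp add: mult_le_cancel_left_pos)
next
  case True
  then show ?thesis using R by simp
qed

section \<open>Balls in regular graphs and walks with a common edge\<close>

text \<open>Adds all neighbours, so that \<open>(expand V E ^^ m) T\<close> is the ball of radius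
  \<open>m\<close> around \<open>T\<close>.\<close>

definition expand :: "nat set \<Rightarrow> (nat \<times> nat) set \<Rightarrow> nat set \<Rightarrow> nat set" where
  "expand V E T = T \<union> (\<Union>v\<in>T. {u \<in> V. adj E v u})"

lemma expand_pow_subset:
  assumes "T \<subseteq> V"
  shows "(expand V E ^^ m) T \<subseteq> V"
  using assms by (induction m) (auto simp: expand_def)

lemma expand_pow_mono:
  assumes "m \<le> n"
  shows "(expand V E ^^ m) T \<subseteq> (expand V E ^^ n) T"
  using assms by (rule lift_Suc_mono_le[rotated]) (auto simp: expand_def)

lemma card_expand_pow_le:
  assumes V: "finite V" and reg: "regular_graph k V E" and T: "T \<subseteq> V"
  shows "card ((expand V E ^^ m) T) \<le> (k + 1) ^ m * card T"
proof (induction m)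
  case (Suc m)
  let ?T = "(expand V E ^^ m) T"
  have sub: "?T \<subseteq> V" by (rule expand_pow_subset[OF T])
  then have fin: "finite ?T" using V by (rule finite_subset)
  have "card (\<Union>v\<in>?T. {u \<in> V. adj E v u}) \<le> (\<Sum>v\<in>?T. card {u \<in> V. adj E v u})"
    by (rule card_UN_le[OF fin])
  also have "\<dots> = card ?T * k"
    using sub reg by (simp add: regular_graph_def subset_iff)
  finally have "card (expand V E ?T) \<le> card ?T + card ?T * k"
    unfolding expand_def[of V E ?T] using card_Un_le[of ?T "\<Union>v\<in>?T. {u \<in> V. adj E v u}"] by linarith
  also have "\<dots> = (k + 1) * card ?T" by simp
  also have "\<dots> \<le> (k + 1) * ((k + 1) ^ m * card T)"
    by (rule mult_le_mono2[OF Suc])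
  finally show ?case by (simp add: algebra_simps)
qed simp

lemma walk_Cons_in_expand_pow:
  assumes "is_walk V E (x # xs)" "x \<in> T"
  shows "set (x # xs) \<subseteq> (expand V E ^^ length xs) T"
  using assms
proof (induction xs arbitrary: x T)
  case (Cons y xs)
  have "is_walk V E (y # xs)" "y \<in> expand V E T"
    using Cons.prems by (auto simp: is_walk_def expand_def)
  from Cons.IH[OF this] have "set (y # xs) \<subseteq> (expand V E ^^ length (y # xs)) T"
    by (simp add: funpow_swap1)
  moreover have "x \<in> (expand V E ^^ length (y # xs)) T"
    using expand_pow_mono[of 0 "length (y # xs)" V E T] Cons.prems by auto
  ultimately show ?case by simp
qed simp

text \<open>Split at \<open>x\<close> and reverse the first half, which gives two walks starting at
  \<open>x\<close>.\<close>

lemma walk_in_expand_pow: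
  assumes "is_walk V E xs" "x \<in> set xs" "x \<in> T"
  shows "set xs \<subseteq> (expand V E ^^ (length xs - 1)) T"
proof -
  obtain as bs where xs: "xs = as @ [x] @ bs"
    using assms(2) by (auto dest: split_list)
  have "is_walk V E (x # bs)" "is_walk V E (rev (as @ [x]))"
    using assms(1) is_walk_append[of V E as x bs] by (simp_all only: xs is_walk_rev)
  then have "set (x # bs) \<subseteq> (expand V E ^^ length bs) T"
    "set (x # rev as) \<subseteq> (expand V E ^^ length (rev as)) T"
    using assms(3) by (intro walk_Cons_in_expand_pow; simp)+
  moreover have "(expand V E ^^ length bs) T \<subseteq> (expand V E ^^ (length xs - 1)) T"
    "(expand V E ^^ length (rev as)) T \<subseteq> (expand V E ^^ (length xs - 1)) T"
    by (rule expand_pow_mono; simp add: xs)+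
  ultimately show ?thesis by (auto simp: xs)
qed

text \<open>A walk sharing an edge with \<open>xs\<close> stays within 2 q of the head of
  \<open>xs\<close>: at most \<open>q\<close> steps along \<open>xs\<close> to a common vertex and
  \<open>q\<close> along the other walk. Counting all lists of vertices in that ball gives a bound
  independent of the size of the graph.\<close>

lemma card_meeting_walks_le:
  assumes V: "finite V" and reg: "regular_graph k V E" and xs: "xs \<in> nb_walks V E q"
  shows "card {ys \<in> nb_walks V E q. walk_edges E xs \<inter> walk_edges E ys \<noteq> {}}
    \<le> ((k + 1) ^ (2 * q)) ^ Suc q"
proof -
  let ?B = "(expand V E ^^ (2 * q)) {hd xs}"
  have walk: "is_walk V E xs" and len: "length xs = Suc q" using xs by (auto simp: nb_walks_def)
  have hd: "hd xs \<in> set xs" "hd xs \<in> V" using walk by (auto simp: is_walk_def)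
  have B: "finite ?B" "card ?B \<le> (k + 1) ^ (2 * q)"
    using expand_pow_subset[of "{hd xs}" V "2 * q" E] card_expand_pow_le[OF V reg, of "{hd xs}" "2 * q"]
      hd V by (auto intro: finite_subset)
  have "set ys \<subseteq> ?B" if ys: "ys \<in> nb_walks V E q" "walk_edges E xs \<inter> walk_edges E ys \<noteq> {}" for ys
  proof -
    obtain e where "e \<in> walk_edges E xs" "e \<in> walk_edges E ys" using ys(2) by blast
    then have z: "fst e \<in> set xs" "fst e \<in> set ys"
      using walk_edges_vertices[of E xs] walk_edges_vertices[of E ys] by auto
    have "set xs \<subseteq> (expand V E ^^ q) {hd xs}"
      using walk_in_expand_pow[OF walk hd(1), of "{hd xs}"] len by simp
    then have "set ys \<subseteq> (expand V E ^^ (length ys - 1)) ((expand V E ^^ q) {hd xs})"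
      using ys(1) z by (intro walk_in_expand_pow) (auto simp: nb_walks_def)
    also have "\<dots> = ?B"
      using ys(1) fun_cong[OF funpow_add[of q q "expand V E"], of "{hd xs}"]
      by (simp add: nb_walks_def mult_2)
    finally show ?thesis .
  qed
  then have "{ys \<in> nb_walks V E q. walk_edges E xs \<inter> walk_edges E ys \<noteq> {}}
      \<subseteq> {ys. set ys \<subseteq> ?B \<and> length ys = Suc q}"
    by (auto simp: nb_walks_def)
  then have "card {ys \<in> nb_walks V E q. walk_edges E xs \<inter> walk_edges E ys \<noteq> {}} \<le> card ?B ^ Suc q"
    using card_mono[OF finite_lists_length_eq[OF B(1), of "Suc q"]]
    by (simp add: card_lists_length_eq[OF B(1)])
  also have "\<dots> \<le> ((k + 1) ^ (2 * q)) ^ Suc q"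
    using B(2) by (rule power_mono) simp
  finally show ?thesis .
qed

section \<open>Frequency of words under random labels\<close>

text \<open>A walk with \<open>q\<close> distinct edges reads a given word of length
  \<open>j * q\<close> with probability (2 d)^(-j q); the threshold is half the resulting expected
  number of walks.\<close>

definition word_frequent :: "nat set \<Rightarrow> (nat \<times> nat) set \<Rightarrow> nat \<Rightarrow> nat \<Rightarrow> nat \<Rightarrow>
    (nat \<times> nat \<Rightarrow> letter list) \<Rightarrow> letter list \<Rightarrow> bool" where
  "word_frequent V E d j q w h \<longleftrightarrow> real (card (nb_walks V E q)) / (2 * real (2 * d) ^ (j * q))
    \<le> real (card {xs \<in> nb_walks V E q. walk_word E w xs = h})"

lemma finite_edges: "simple_graph V E \<Longrightarrow> finite E"
  unfolding simple_graph_def by (meson finite_SigmaI finite_subset)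

text \<open>The second moment method with \<open>1 / K\<close>, the chance that a given walk reads
  \<open>h\<close>. Walks without a common edge are independent because they prescribe disjoint sets
  of labels. For fixed \<open>q\<close> the exceptional probability is thus of the order of the
  inverse number of walks.\<close>

lemma card_infrequent_le:
  assumes graph: "simple_graph V E" and reg: "regular_graph k V E" and d: "0 < d"
    and girth: "\<And>c. is_cycle V E c \<Longrightarrow> q < length c" and h: "h \<in> words d (j * q)"
  shows "real (card {w \<in> Pi\<^sub>E E (\<lambda>_. words d j). \<not> word_frequent V E d j q w h})
      * real (card (nb_walks V E q))
    \<le> 4 * real (((k + 1) ^ (2 * q)) ^ Suc q) * (real (2 * d) ^ (j * q))\<^sup>2
      * real (card (Pi\<^sub>E E (\<lambda>_. words d j)))"
proof -
  let ?P = "nb_walks V E q" and ?\<Omega> = "Pi\<^sub>E E (\<lambda>_. words d j)"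
  define K where "K = real (2 * d) ^ (j * q)"
  have K: "0 < K" using d by (simp add: K_def)
  have E: "finite E" by (rule finite_edges[OF graph])
  have V: "finite V" using graph by (simp add: simple_graph_def)
  have W: "finite (words d j)" "words d j \<noteq> {}"
    using finite_words card_words[of d j] d by auto
  have cW: "real (card (words d j)) ^ q = K"
    by (simp add: card_words K_def power_mult)
  have walk: "distinct xs" "successively (adj E) xs" "length xs - 1 = q" if "xs \<in> ?P" for xs
    using that nb_walk_distinct[OF graph girth that] by (auto simp: nb_walks_def is_walk_def)
  have "\<exists>c. (\<forall>e\<in>walk_edges E xs. c e \<in> words d j) \<and>
      (\<forall>w\<in>?\<Omega>. walk_word E w xs = h \<longleftrightarrow> (\<forall>e\<in>walk_edges E xs. w e = c e))" if "xs \<in> ?P" for xs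
  proof -
    from walk_word_eq_iff[OF walk(1,2)[OF that], of h d j] walk(3)[OF that] h
    obtain c where c: "\<forall>e\<in>walk_edges E xs. c e \<in> words d j"
      "\<And>w. \<forall>e\<in>E. w e \<in> words d j \<Longrightarrow>
        (walk_word E w xs = h \<longleftrightarrow> (\<forall>e\<in>walk_edges E xs. w e = c e))" by auto
    have "walk_word E w xs = h \<longleftrightarrow> (\<forall>e\<in>walk_edges E xs. w e = c e)" if "w \<in> ?\<Omega>" for w
      by (rule c(2)) (use that in auto)
    with c(1) show ?thesis by blast
  qed
  then obtain c where "\<forall>xs\<in>?P. (\<forall>e\<in>walk_edges E xs. c xs e \<in> words d j) \<and>
      (\<forall>w\<in>?\<Omega>. walk_word E w xs = h \<longleftrightarrow> (\<forall>e\<in>walk_edges E xs. w e = c xs e))"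
    by (rule bchoice[OF ballI, THEN exE])
  then have c: "\<And>xs e. xs \<in> ?P \<Longrightarrow> e \<in> walk_edges E xs \<Longrightarrow> c xs e \<in> words d j"
    "\<And>xs w. xs \<in> ?P \<Longrightarrow> w \<in> ?\<Omega> \<Longrightarrow>
      walk_word E w xs = h \<longleftrightarrow> (\<forall>e\<in>walk_edges E xs. w e = c xs e)"
    by simp_all
  have sub: "walk_edges E xs \<subseteq> E" "card (walk_edges E xs) = q" if "xs \<in> ?P" for xs
    using walk_edges_subset[OF walk(2)[OF that]] card_walk_edges[OF walk(1)[OF that]]
      walk(3)[OF that] by auto
  have "real (card {w \<in> ?\<Omega>. real (card {xs \<in> ?P. walk_word E w xs = h}) < 1 / K * real (card ?P) / 2})
      * ((1 / K)\<^sup>2 * real (card ?P))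
      \<le> 4 * real (((k + 1) ^ (2 * q)) ^ Suc q) * real (card ?\<Omega>)"
  proof (rule second_moment_bound[where dep = "\<lambda>xs ys. walk_edges E xs \<inter> walk_edges E ys \<noteq> {}"])
    show "finite ?\<Omega>" using E W by (intro finite_PiE)
    show "finite ?P" by (rule finite_nb_walks[OF V])
  next
    fix xs assume xs: "xs \<in> ?P"
    have "{w \<in> ?\<Omega>. walk_word E w xs = h} = {w \<in> ?\<Omega>. \<forall>e\<in>walk_edges E xs. w e = c xs e}"
      using c(2)[OF xs] by blast
    then show "real (card {w \<in> ?\<Omega>. walk_word E w xs = h}) = 1 / K * real (card ?\<Omega>)"
      using card_PiE_prescribed[OF E sub(1)[OF xs] c(1)[OF xs] W] by (simp add: sub(2)[OF xs] cW)
  next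
    fix xs ys assume xs: "xs \<in> ?P" and ys: "ys \<in> ?P"
      and "\<not> walk_edges E xs \<inter> walk_edges E ys \<noteq> {}"
    then have disj: "walk_edges E xs \<inter> walk_edges E ys = {}" by simp
    \<comment> \<open>Without a common edge the two prescriptions merge into one.\<close>
    define c' where "c' e = (if e \<in> walk_edges E xs then c xs e else c ys e)" for e
    let ?F = "walk_edges E xs \<union> walk_edges E ys"
    have "(\<forall>e\<in>?F. w e = c' e) \<longleftrightarrow> walk_word E w xs = h \<and> walk_word E w ys = h" if "w \<in> ?\<Omega>" for w
    proof -
      have "(\<forall>e\<in>walk_edges E ys. w e = c' e) \<longleftrightarrow> (\<forall>e\<in>walk_edges E ys. w e = c ys e)"
        using disj by (intro ball_cong) (auto simp: c'_def)
      then show ?thesis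
        unfolding c(2)[OF xs that] c(2)[OF ys that] ball_Un by (simp add: c'_def)
    qed
    then have "{w \<in> ?\<Omega>. walk_word E w xs = h \<and> walk_word E w ys = h}
        = {w \<in> ?\<Omega>. \<forall>e\<in>?F. w e = c' e}" by blast
    moreover have "card ?F = q + q"
      using disj sub xs ys by (simp add: card_Un_disjoint finite_walk_edges)
    moreover have "real (card {w \<in> ?\<Omega>. \<forall>e\<in>?F. w e = c' e})
        = real (card ?\<Omega>) / real (card (words d j)) ^ card ?F"
      using sub(1)[OF xs] sub(1)[OF ys] c(1)[OF xs] c(1)[OF ys]
      by (intro card_PiE_prescribed E W) (auto simp: c'_def)
    ultimately show "real (card {w \<in> ?\<Omega>. walk_word E w xs = h \<and> walk_word E w ys = h})
        = (1 / K)\<^sup>2 * real (card ?\<Omega>)"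
      by (simp add: power_add cW power2_eq_square)
  next
    fix xs assume "xs \<in> ?P"
    from card_meeting_walks_le[OF V reg this]
    show "real (card {ys \<in> ?P. walk_edges E xs \<inter> walk_edges E ys \<noteq> {}})
        \<le> real (((k + 1) ^ (2 * q)) ^ Suc q)" by (rule of_nat_mono)
  qed (use K in auto)
  moreover have "{w \<in> ?\<Omega>. real (card {xs \<in> ?P. walk_word E w xs = h}) < 1 / K * real (card ?P) / 2}
      = {w \<in> ?\<Omega>. \<not> word_frequent V E d j q w h}"
    by (auto simp: word_frequent_def K_def not_le)
  ultimately show ?thesis
    using K unfolding K_def[symmetric] by (simp add: power_divide field_simps)
qed

section \<open>From the Poincare inequality to random words\<close>

text \<open>Pass from words to walks by \<open>word_frequent\<close>, from walks to pairs of
  vertices by equidistribution of the endpoints, and from pairs to edges by the expander inequality.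
  The first two passages lose a factor 2 each, hence the 4; the quasi-triangle inequality adds 2^p.
  The constant is independent of \<open>q\<close>.\<close>

lemma (in graph_action) moment_bound:
  assumes d: "0 < d" and p: "0 < p" and \<gamma>: "0 < \<gamma>" and k: "2 \<le> k" and V: "V \<noteq> {}"
    and reg: "regular_graph k V E" and exp: "p_expander_ineq p \<gamma> TYPE('a) V E"
    and w: "\<And>e. e \<in> E \<Longrightarrow> w e \<in> words d j"
    and freq: "\<And>h. h \<in> words d (j * q) \<Longrightarrow> word_frequent V E d j q w h"
  shows "(isometry_family.avg (gens d) (\<lambda>a. word_act [a]) ^^ (j * q)) (\<lambda>y. dist y x powr p) x
    \<le> 4 * 2 powr p * \<gamma> * (real j powr p * real (2 * d))
      * isometry_family.displacement (gens d) (\<lambda>a. word_act [a]) p x"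
proof -
  interpret isometry_family "gens d" "\<lambda>a. word_act [a]" p
    by (rule isometry_family_gens[OF d p])
  let ?P = "nb_walks V E q"
  \<comment> \<open>Bounds the energy of a single edge, whose label consists of \<open>j\<close>
    letters.\<close>
  define b where "b = real j powr p * (real (2 * d) * displacement x)"
  have b: "0 \<le> b" using displacement_nonneg by (simp add: b_def)
  have fin: "finite V" using graph by (simp add: simple_graph_def)
  have cV: "0 < real (card V)" using fin V by (simp add: card_gt_0_iff)
  obtain f :: "nat \<Rightarrow> 'a" where f: "\<And>xs. is_walk V E xs \<Longrightarrow>
      dist (f (hd xs)) (f (last xs)) = dist x (word_act (walk_word E w xs) x)"
    using potential_exists by blast
  obtain \<delta> where \<delta>: "0 \<le> \<delta>" "\<delta> powr p = real (card (gens d)) * displacement x"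
    "\<And>a. a \<in> gens d \<Longrightarrow> dist x (word_act [a] x) \<le> \<delta>"
    using displacement_root[of x] by blast
  have edge: "dist (f u) (f v) powr p \<le> b" if "(u, v) \<in> E" for u v
  proof -
    have "is_walk V E [u, v]"
      using that graph by (auto simp: is_walk_def adj_def simple_graph_def)
    from f[OF this] have "dist (f u) (f v) = dist x (word_act (w (u, v)) x)"
      using that by (simp add: traverse_word_def)
    also have "\<dots> \<le> real j * \<delta>"
      using dist_word_act_le[OF \<delta>(3), of "w (u, v)"] w[OF that] by (simp add: words_def)
    finally have "dist (f u) (f v) powr p \<le> (real j * \<delta>) powr p"
      using p by (intro powr_mono2) auto
    then show ?thesis using \<delta> by (simp add: powr_mult b_def card_gens)
  qed
  have "(\<gamma> / real (card E)) * (\<Sum>(u,v)\<in>E. dist (f u) (f v) powr p) \<le> \<gamma> * b"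
  proof (cases "E = {}")
    case True
    then show ?thesis using \<gamma> b by simp
  next
    case False
    then have cE: "0 < real (card E)" using finite_edges[OF graph] by (simp add: card_gt_0_iff)
    have "(\<Sum>(u,v)\<in>E. dist (f u) (f v) powr p) \<le> real (card E) * b"
      using edge by (intro sum_bounded_above) auto
    then have "(\<gamma> / real (card E)) * (\<Sum>(u,v)\<in>E. dist (f u) (f v) powr p)
        \<le> (\<gamma> / real (card E)) * (real (card E) * b)"
      using \<gamma> by (intro mult_left_mono) auto
    also have "\<dots> = \<gamma> * b" using cE by simp
    finally show ?thesis .
  qed
  then have "(1 / real (card V) ^ 2) * (\<Sum>u\<in>V. \<Sum>v\<in>V. dist (f u) (f v) powr p) \<le> \<gamma> * b"
    using exp unfolding p_expander_ineq_def by (meson order_trans)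
  then have pairs: "(\<Sum>u\<in>V. \<Sum>v\<in>V. dist (f u) (f v) powr p) \<le> real (card V) ^ 2 * (\<gamma> * b)"
    using cV by (simp add: field_simps)
  have "real (card V) * (\<Sum>xs\<in>?P. dist (f (hd xs)) (f (last xs)) powr p)
      \<le> 2 powr p * (2 * real (nb_count k q)) * (\<Sum>u\<in>V. \<Sum>v\<in>V. dist (f u) (f v) powr p)"
    using p by (intro sum_nb_walks_dist_le fin reg) simp
  also have "\<dots> \<le> 2 powr p * (2 * real (nb_count k q)) * (real (card V) ^ 2 * (\<gamma> * b))"
    by (intro mult_left_mono pairs) auto
  also have "\<dots> = real (card V) * (2 * 2 powr p * \<gamma> * b * real (card ?P))"
    by (simp add: card_nb_walks[OF fin reg] power2_eq_square)
  finally have upper: "(\<Sum>xs\<in>?P. dist (f (hd xs)) (f (last xs)) powr p)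
      \<le> 2 * 2 powr p * \<gamma> * b * real (card ?P)"
    using cV by (simp only: mult_le_cancel_left_pos)
  define K where "K = real (2 * d) ^ (j * q)"
  have K: "0 < K" using d by (simp add: K_def)
  define g where "g h = dist x (word_act h x) powr p" for h
  have walk_word_words: "walk_word E w xs \<in> words d (j * q)" if "xs \<in> ?P" for xs
  proof -
    have "length (walk_word E w ys) = j * (length ys - 1)" if "successively (adj E) ys" for ys
      using that
    proof (induction ys rule: remdups_adj.induct)
      case (3 a b ys)
      then have "length (traverse_word E w a b) = j"
        using w by (auto simp: traverse_word_def adj_def words_def winv_def)
      then show ?case using 3 by (cases "a = b") (use not_adj_self in auto)
    qed auto
    then show ?thesis
      using that walk_word_lists[of xs] by (auto simp: nb_walks_def is_walk_def words_def)
  qed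
  \<comment> \<open>Weighting every \<open>g h\<close> by the number of walks that read
    \<open>h\<close> turns the sum over words into a sum over walks.\<close>
  have "(real (card ?P) / (2 * K)) * (\<Sum>h\<in>words d (j * q). g h)
      = (\<Sum>h\<in>words d (j * q). (real (card ?P) / (2 * K)) * g h)"
    by (rule sum_distrib_left)
  also have "\<dots> \<le> (\<Sum>h\<in>words d (j * q). real (card {xs \<in> ?P. walk_word E w xs = h}) * g h)"
    using freq unfolding word_frequent_def K_def[symmetric]
    by (intro sum_mono mult_right_mono) (auto simp: g_def)
  also have "\<dots> = (\<Sum>h\<in>words d (j * q). \<Sum>xs\<in>{xs \<in> ?P. walk_word E w xs = h}. g (walk_word E w xs))"
    by (intro sum.cong) auto
  also have "\<dots> = (\<Sum>xs\<in>?P. g (walk_word E w xs))"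
    using walk_word_words by (intro sum.group) (auto simp: finite_nb_walks[OF fin] finite_words)
  also have "\<dots> = (\<Sum>xs\<in>?P. dist (f (hd xs)) (f (last xs)) powr p)"
    by (intro sum.cong) (auto simp: g_def nb_walks_def f)
  also note upper
  finally have "real (card ?P) * ((\<Sum>h\<in>words d (j * q). g h) / (2 * K))
      \<le> real (card ?P) * (2 * 2 powr p * \<gamma> * b)"
    by (simp add: mult.commute)
  \<comment> \<open>From 2 \<le> k it follows that walks exist, so their number can be
    cancelled.\<close>
  moreover have "0 < real (card ?P)"
    using k cV by (auto simp: card_nb_walks[OF fin reg] nb_count_def)
  ultimately have "(\<Sum>h\<in>words d (j * q). g h) / (2 * K) \<le> 2 * 2 powr p * \<gamma> * b"
    by (simp only: mult_le_cancel_left_pos)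
  then have "(\<Sum>h\<in>words d (j * q). g h) / K \<le> 4 * 2 powr p * \<gamma> * b"
    using K by (simp add: field_simps)
  then show ?thesis
    unfolding avg_pow_eq_sum_words[OF d p]
    by (simp add: g_def K_def b_def mult.assoc dist_commute[of _ x])
qed

section \<open>Expanders of degree at most one\<close>

text \<open>A vertex and its neighbours then form a set of at most two elements that no edge leaves.
  A function with value \<open>x\<close> on this set and \<open>y\<close> elsewhere has no energy
  along the edges but, because of a third vertex, a positive sum over all pairs unless x =
  y.\<close>

lemma expander_low_degree_imp_trivial:
  assumes graph: "simple_graph V E" and reg: "regular_graph k V E" and k: "k \<le> 1"
    and V: "3 \<le> card V" and exp: "p_expander_ineq p \<gamma> TYPE('a::metric_space) V E" and p: "0 < p"
  shows "(x::'a) = y"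
proof (rule ccontr)
  assume xy: "x \<noteq> y"
  have fin: "finite V" using graph by (simp add: simple_graph_def)
  obtain u where u: "u \<in> V" using V by (metis card.empty equals0I not_numeral_le_zero)
  define T where "T = insert u {v \<in> V. adj E u v}"
  have cT: "card T \<le> 2"
    using reg u k card_insert_le_m1[of 2 "{v \<in> V. adj E u v}" u]
    by (simp add: T_def regular_graph_def)
  have "T \<subseteq> V" using u by (auto simp: T_def)
  moreover have "T \<noteq> V" using cT V by auto
  ultimately obtain v where v: "v \<in> V" "v \<notin> T" by blast
  define f where "f z = (if z \<in> T then x else y)" for z
  have closed: "b \<in> T" if "a \<in> T" "adj E a b" for a b
  proof (cases "a = u")
    case True
    then show ?thesis using that graph by (auto simp: T_def adj_def simple_graph_def)
  next
    case False
    then have a: "a \<in> V" "adj E u a" using that by (auto simp: T_def)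
    have "b \<in> V" using that graph by (auto simp: adj_def simple_graph_def)
    have "card {c \<in> V. adj E a c} \<le> 1" using reg a k by (simp add: regular_graph_def)
    moreover have "u \<in> {c \<in> V. adj E a c}" using a u adj_commute by auto
    moreover have "b \<in> {c \<in> V. adj E a c}" using that \<open>b \<in> V\<close> by simp
    ultimately have "b = u"
      using fin by (auto dest!: card_le_Suc0_iff_eq[THEN iffD1, rotated])
    then show ?thesis by (simp add: T_def)
  qed
  have "f a = f b" if "(a, b) \<in> E" for a b
    using closed[of a b] closed[of b a] that by (auto simp: f_def adj_def)
  then have "(\<Sum>(u,v)\<in>E. dist (f u) (f v) powr p) = 0"
    using p by (intro sum.neutral) auto
  then have "(1 / real (card V) ^ 2) * (\<Sum>u\<in>V. \<Sum>v\<in>V. dist (f u) (f v) powr p) \<le> 0"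
    using exp unfolding p_expander_ineq_def by (metis mult_zero_right)
  then have le: "(\<Sum>u\<in>V. \<Sum>v\<in>V. dist (f u) (f v) powr p) \<le> 0"
    using V by (simp add: field_simps zero_less_mult_iff split: if_splits)
  have "0 < dist (f u) (f v) powr p"
    using xy v by (auto simp: f_def T_def)
  also have "\<dots> \<le> (\<Sum>v\<in>V. dist (f u) (f v) powr p)"
    using fin v by (intro member_le_sum) auto
  also have "\<dots> \<le> (\<Sum>u\<in>V. \<Sum>v\<in>V. dist (f u) (f v) powr p)"
    using fin u by (intro member_le_sum[of u V "\<lambda>u. \<Sum>v\<in>V. dist (f u) (f v) powr p"] sum_nonneg) auto
  finally show False using le by simp
qed

section \<open>The fixed point property of the random group\<close>

text \<open>\<open>D\<close> times the displacement bounds the energy of an edge, and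
  \<open>B\<close> times it the moments at all lengths up to \<open>n\<close>. Neither constant
  depends on \<open>n\<close> or the graph, so \<open>n\<close> can be chosen after
  \<open>B\<close>.\<close>

lemma fixed_point_property_of_frequent_words:
  fixes p c \<gamma> :: real and d j k n :: nat
  defines "D \<equiv> real j powr p * real (2 * d)"
  defines "B \<equiv> 2 powr p * (4 * 2 powr p * \<gamma> * D + D)"
  assumes p: "0 < p" and geodesic: "geodesic_space TYPE('a::complete_space)" and c: "0 < c"
    and convex: "\<forall>x y z::'a. \<forall>g. geodesic_segment g y z \<longrightarrow> (\<forall>t\<in>{0..1}. dist x (g t) powr p
      \<le> (1 - t) * dist x y powr p + t * dist x z powr p - c * t * (1 - t) * dist y z powr p)"
    and graph: "simple_graph V E" and reg: "regular_graph k V E" and k: "2 \<le> k" and V: "V \<noteq> {}"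
    and \<gamma>: "0 < \<gamma>" and expander: "p_expander_ineq p \<gamma> TYPE('a) V E"
    and d: "0 < d" and j: "0 < j"
    and n: "0 < n" "2 powr p * (4 / c * (B + 2)) / real n \<le> 1 / 2"
    and w: "w \<in> Pi\<^sub>E E (\<lambda>_. words d j)"
    and freq: "\<And>q h. q \<le> n \<Longrightarrow> h \<in> words d (j * q) \<Longrightarrow> word_frequent V E d j q w h"
  shows "fixed_point_property (graph_group V E d w) TYPE('a)"
  unfolding fixed_point_property_def
proof (intro allI impI)
  fix \<phi> :: "letter list set \<Rightarrow> 'a \<Rightarrow> 'a"
  assume \<phi>: "isometric_action (graph_group V E d w) \<phi>"
  have w': "w e \<in> words d j" if "e \<in> E" for e
    using w that by auto
  interpret graph_action d V E w \<phi>
    using \<phi> graph w' by unfold_locales (auto simp: graph_group_def words_def)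
  interpret isometry_family "gens d" "\<lambda>a. word_act [a]" p
    by (rule isometry_family_gens[OF d p])
  have convex_family: "uniformly_convex_isometry_family (gens d) (\<lambda>a. word_act [a]) p c"
    by unfold_locales (use geodesic c convex in auto)
  have D: "0 \<le> D" by (simp add: D_def)
  have B: "0 \<le> B" using D \<gamma> by (simp add: B_def)
  have "(avg ^^ m) (pdist x) x \<le> B * displacement x" if "m \<le> n" for m x
  proof -
    \<comment> \<open>\<open>moment_bound\<close> treats multiples of \<open>j\<close>; for the last
      one up to \<open>m\<close> the quotient is at most \<open>n\<close>, so the words of that
      length are frequent.\<close>
    have "m div j \<le> n" using that div_le_dividend[of m j] by linarith
    then have "(avg ^^ (j * (m div j))) (pdist x) x \<le> 4 * 2 powr p * \<gamma> * D * displacement x"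
      using moment_bound[OF d p \<gamma> k V reg expander w' freq] unfolding D_def by blast
    then have "(avg ^^ m) (pdist x) x
        \<le> 2 powr p * (4 * 2 powr p * \<gamma> * D + real j powr p * real (card (gens d))) * displacement x"
      using D \<gamma> by (intro avg_pow_le_of_multiples j) auto
    then show ?thesis by (simp add: B_def D_def card_gens)
  qed
  from common_fixed_point_of_bounded_moments[OF convex_family B n this]
  obtain x where "\<forall>a\<in>gens d. word_act [a] x = x" by blast
  then have "has_common_fixed_point (presented_group d (graph_relators V E w)) \<phi>"
    by (intro common_fixed_pointI) auto
  then show "has_common_fixed_point (graph_group V E d w) \<phi>"
    by (simp add: graph_group_def)
qed

text \<open>Union bound over the words of lengths \<open>j * q\<close> with q \<le> n. As 2 \<le> k,
  there are at least \<open>card V\<close> walks of each length, and the sum on the right does not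
  grow with the graph, so the proportion of exceptional labellings is O(1 /
  \<open>card V\<close>).\<close>

lemma card_exceptional_le:
  assumes graph: "simple_graph V E" and reg: "regular_graph k V E" and k: "2 \<le> k" and d: "0 < d"
    and girth: "\<And>c. is_cycle V E c \<Longrightarrow> n < length c"
  shows "real (card {w \<in> Pi\<^sub>E E (\<lambda>_. words d j).
        \<exists>q\<le>n. \<exists>h\<in>words d (j * q). \<not> word_frequent V E d j q w h}) * real (card V)
    \<le> (\<Sum>q\<le>n. \<Sum>h\<in>words d (j * q).
        4 * real (((k + 1) ^ (2 * q)) ^ Suc q) * (real (2 * d) ^ (j * q))\<^sup>2)
      * real (card (Pi\<^sub>E E (\<lambda>_. words d j)))"
    (is "real (card ?bad) * _ \<le> (\<Sum>q\<le>n. \<Sum>h\<in>words d (j * q). ?L q) * real (card ?\<Omega>)")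
proof -
  have V: "finite V" using graph by (simp add: simple_graph_def)
  define A where "A q h = {w \<in> ?\<Omega>. \<not> word_frequent V E d j q w h}" for q h
  have "?bad = (\<Union>q\<in>{..n}. \<Union>h\<in>words d (j * q). A q h)"
    by (auto simp: A_def)
  then have "card ?bad \<le> (\<Sum>q\<le>n. card (\<Union>h\<in>words d (j * q). A q h))"
    using card_UN_le[of "{..n}"] by simp
  also have "\<dots> \<le> (\<Sum>q\<le>n. \<Sum>h\<in>words d (j * q). card (A q h))"
    by (intro sum_mono card_UN_le finite_words)
  finally have "real (card ?bad) \<le> real (\<Sum>q\<le>n. \<Sum>h\<in>words d (j * q). card (A q h))"
    by (rule of_nat_mono)
  then have "real (card ?bad) * real (card V)
      \<le> (\<Sum>q\<le>n. \<Sum>h\<in>words d (j * q). real (card (A q h))) * real (card V)"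
    by (intro mult_right_mono) auto
  also have "\<dots> = (\<Sum>q\<le>n. \<Sum>h\<in>words d (j * q). real (card (A q h)) * real (card V))"
    by (simp add: sum_distrib_right)
  also have "\<dots> \<le> (\<Sum>q\<le>n. \<Sum>h\<in>words d (j * q). ?L q * real (card ?\<Omega>))"
  proof (intro sum_mono)
    fix q h assume q: "q \<in> {..n}" and h: "h \<in> words d (j * q)"
    have "1 \<le> nb_count k q" using k by (auto simp: nb_count_def)
    then have "real (card V) \<le> real (card (nb_walks V E q))"
      unfolding card_nb_walks[OF V reg] by (simp add: mult_le_cancel_right1)
    then have "real (card (A q h)) * real (card V) \<le> real (card (A q h)) * real (card (nb_walks V E q))"
      by (intro mult_left_mono) auto
    also have "\<dots> \<le> ?L q * real (card ?\<Omega>)"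
      unfolding A_def
    proof (rule card_infrequent_le[OF graph reg d _ h])
      show "q < length c" if "is_cycle V E c" for c using girth[OF that] q by simp
    qed
    finally show "real (card (A q h)) * real (card V) \<le> ?L q * real (card ?\<Omega>)" .
  qed
  also have "\<dots> = (\<Sum>q\<le>n. \<Sum>h\<in>words d (j * q). ?L q) * real (card ?\<Omega>)"
    by (simp only: sum_distrib_right)
  finally show ?thesis .
qed

theorem theorem1p1:
  fixes p :: real and k :: nat and \<gamma> \<eta> :: real
    and V :: "nat \<Rightarrow> nat set" and E :: "nat \<Rightarrow> (nat \<times> nat) set"
    and d j :: nat
  assumes "p \<ge> 2"
    and "geodesic_space TYPE('a::complete_space)"
    and "p_uniformly_convex p TYPE('a)"
    and "admits_high_girth_expanders p TYPE('a) k \<gamma> \<eta> V E"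
    and "d \<ge> 2" and "j \<ge> 1"
  shows "(\<lambda>n. random_group_prob (V n) (E n) d j (\<lambda>G. fixed_point_property G TYPE('a)))
           \<longlonglongrightarrow> 1"
proof -
  have p: "0 < p" and d: "0 < d" and j: "0 < j" using assms by auto
  obtain c where c: "0 < c" and convex: "\<forall>x y z::'a. \<forall>g. geodesic_segment g y z \<longrightarrow>
      (\<forall>t\<in>{0..1}. dist x (g t) powr p
        \<le> (1 - t) * dist x y powr p + t * dist x z powr p - c * t * (1 - t) * dist y z powr p)"
    using assms(3) unfolding p_uniformly_convex_def by blast
  have \<gamma>: "0 < \<gamma>" and \<eta>: "0 < \<eta>"
    and graph: "\<And>n. simple_graph (V n) (E n)" and reg: "\<And>n. regular_graph k (V n) (E n)"
    and girth: "\<And>n. girth_at_least (V n) (E n) (\<eta> * ln (real (card (V n))))"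
    and expander: "\<And>n. p_expander_ineq p \<gamma> TYPE('a) (V n) (E n)"
    and card_V: "filterlim (\<lambda>n. card (V n)) at_top sequentially"
    using assms(4) unfolding admits_high_girth_expanders_def by auto
  define \<Omega> where "\<Omega> n = Pi\<^sub>E (E n) (\<lambda>_. words d j)" for n
  define good where
    "good n = {w \<in> \<Omega> n. fixed_point_property (graph_group (V n) (E n) d w) TYPE('a)}" for n
  have prob: "random_group_prob (V n) (E n) d j (\<lambda>G. fixed_point_property G TYPE('a))
      = real (card (good n)) / real (card (\<Omega> n))" for n
    by (simp add: random_group_prob_def good_def \<Omega>_def)
  have fin: "finite (\<Omega> n)" for n
    unfolding \<Omega>_def using finite_edges[OF graph] by (intro finite_PiE) (auto simp: finite_words)
  have card_\<Omega>: "0 < real (card (\<Omega> n))" for n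
    unfolding \<Omega>_def using finite_edges[OF graph, of n] d by (simp add: card_PiE card_words)
  show ?thesis
  proof (cases "k \<le> 1")
    case True
    \<comment> \<open>One graph with three vertices forces the space to be a single point, which
      every action fixes.\<close>
    obtain n0 where "3 \<le> card (V n0)"
      using card_V unfolding filterlim_at_top eventually_sequentially by blast
    then have trivial: "x = y" for x y :: 'a
      using expander_low_degree_imp_trivial[OF graph reg True _ expander p] by blast
    then have "fixed_point_property G TYPE('a)" for G :: "letter list set monoid"
      unfolding fixed_point_property_def has_common_fixed_point_def by blast
    then have "random_group_prob (V n) (E n) d j (\<lambda>G. fixed_point_property G TYPE('a)) = 1" for n
      unfolding prob good_def using card_\<Omega>[of n] by simp
    then show ?thesis by simp
  next
    case False
    then have k: "2 \<le> k" by simp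
    define D where "D = real j powr p * real (2 * d)"
    define B where "B = 2 powr p * (4 * 2 powr p * \<gamma> * D + D)"
    define L where "L = 2 powr p * (4 / c * (B + 2))"
    \<comment> \<open>This length does not depend on the graph. Doubling \<open>L\<close> yields the
      ratio 1/2 that halves the displacement, and \<open>Suc\<close> makes \<open>N\<close>
      positive.\<close>
    define N where "N = Suc (nat \<lceil>2 * L\<rceil>)"
    have N: "0 < N" "2 * L \<le> real N"
      unfolding N_def by simp linarith
    then have LN: "L / real N \<le> 1 / 2" by (simp add: pos_divide_le_eq)
    \<comment> \<open>Also independent of the graph, so that \<open>M / real (card (V n))\<close>,
      the bound on the exceptional probability, tends to 0.\<close>
    define M where "M = (\<Sum>q\<le>N. \<Sum>h\<in>words d (j * q).
      4 * real (((k + 1) ^ (2 * q)) ^ Suc q) * (real (2 * d) ^ (j * q))\<^sup>2)"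
    have card_V_real: "filterlim (\<lambda>n. real (card (V n))) at_top sequentially"
      using filterlim_compose[OF filterlim_real_sequentially card_V] .
    have "filterlim (\<lambda>n. \<eta> * ln (real (card (V n)))) at_top sequentially"
      by (intro filterlim_tendsto_pos_mult_at_top[OF tendsto_const \<eta>]
          filterlim_compose[OF ln_at_top card_V_real])
    \<comment> \<open>With \<open>N\<close> fixed, the logarithmic girth eventually exceeds
      it.\<close>
    then have "eventually (\<lambda>n. real N < \<eta> * ln (real (card (V n)))) sequentially"
      by (simp add: filterlim_at_top_dense)
    then have lower: "eventually (\<lambda>n. 1 - M / real (card (V n))
        \<le> random_group_prob (V n) (E n) d j (\<lambda>G. fixed_point_property G TYPE('a))) sequentially"
      using card_V_real[unfolded filterlim_at_top_dense, rule_format, of 0]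
    proof eventually_elim
      case (elim n)
      have long: "N < length c" if "is_cycle (V n) (E n) c" for c
      proof -
        have "\<eta> * ln (real (card (V n))) \<le> real (length c)"
          using girth[of n] that by (simp add: girth_at_least_def)
        then show ?thesis using elim by linarith
      qed
      let ?bad = "{w \<in> \<Omega> n. \<exists>q\<le>N. \<exists>h\<in>words d (j * q). \<not> word_frequent (V n) (E n) d j q w h}"
      have Vn: "V n \<noteq> {}" using elim by auto
      \<comment> \<open>A labelling under which all relevant words are frequent yields a group with
        the fixed point property.\<close>
      have "w \<in> good n" if w: "w \<in> \<Omega> n" "w \<notin> ?bad" for w
      proof -
        have "word_frequent (V n) (E n) d j q w h" if "q \<le> N" "h \<in> words d (j * q)" for q h
          using w that by blast
        from fixed_point_property_of_frequent_words[OF p assms(2) c convex graph reg k Vn \<gamma>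
            expander d j N(1) LN[unfolded L_def B_def D_def] w(1)[unfolded \<Omega>_def] this]
        show ?thesis using w by (simp add: good_def)
      qed
      then have "\<Omega> n \<subseteq> good n \<union> ?bad" by blast
      moreover have "finite (good n \<union> ?bad)" using fin[of n] by (simp add: good_def)
      ultimately have "card (\<Omega> n) \<le> card (good n \<union> ?bad)"
        by (rule card_mono[rotated])
      also have "\<dots> \<le> card (good n) + card ?bad" by (rule card_Un_le)
      finally have "real (card (\<Omega> n)) \<le> real (card (good n)) + real (card ?bad)"
        by linarith
      moreover have "real (card ?bad) \<le> M * real (card (\<Omega> n)) / real (card (V n))"
      proof -
        have "real (card ?bad) * real (card (V n)) \<le> M * real (card (\<Omega> n))"
          unfolding \<Omega>_def M_def by (rule card_exceptional_le[OF graph reg k d long])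
        then show ?thesis using elim by (simp add: pos_le_divide_eq)
      qed
      ultimately have "real (card (\<Omega> n)) * (1 - M / real (card (V n))) \<le> real (card (good n))"
        by (simp add: algebra_simps)
      then show ?case
        using card_\<Omega>[of n] by (simp add: prob pos_le_divide_eq mult.commute)
    qed
    have "(\<lambda>n. 1 - M / real (card (V n))) \<longlonglongrightarrow> 1 - 0"
      by (intro tendsto_diff tendsto_const tendsto_divide_0[OF tendsto_const]
          filterlim_at_top_imp_at_infinity card_V_real)
    moreover have "random_group_prob (V n) (E n) d j (\<lambda>G. fixed_point_property G TYPE('a)) \<le> 1" for n
      using card_mono[OF fin[of n], of "good n"] card_\<Omega>[of n] by (simp add: prob good_def)
    ultimately show ?thesis
      by (intro tendsto_sandwich[OF lower _ _ tendsto_const]) auto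
  qed
qed

end
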